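(* Let $\ell$ be an odd prime and let $\omega_\ell=2$ if $\ell\equiv1\pmod 4$ and $\omega_\ell=1$ if $\ell\equiv3\pmod4$. Then, with $q=e^{\pi i\tau}$, the function $\tau\mapsto\widehat{D}_\ell^{\,\omega_\ell}(q^2)$ is a modular function on $\Gamma_0(2\ell)+W_\ell$.
   Context: For $0<|q|<1$ let $\vartheta_4(q)=\sum_{k\in\mathbb Z}(-1)^kq^{k^2}$ and for a positive integer $\ell$ define $$\widehat{D}_\ell(q)=\frac{1}{\vartheta_4^3(q)\vartheta_4^3(q^\ell)}\det\begin{pmatrix}\vartheta_4(q)&\vartheta_4(q^\ell)\\ q\frac{d\vartheta_4(q)}{dq}& q\frac{d\vartheta_4(q^\ell)}{dq}\end{pmatrix}.$$ $\Gamma_0(N)=\{\begin{pmatrix}a&b\\c&d\end{pmatrix}\in SL_2(\mathbb Z): c\equiv0\pmod N\}$. For $e\mid N$ with $\gcd(N/e,e)=1$, $W_e$ denotes a matrix $\begin{pmatrix}a\sqrt e& b/\sqrt e\\ cN/\sqrt e& d\sqrt e\end{pmatrix}$ with $a,b,c,d\in\mathbb Z$ and determinant $1$, and $\Gamma_0(N)+W_e$ is the group generated by $\Gamma_0(N)$ and $W_e$, acting on the upper half-plane by Möbius transformations. *)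

theory Defs
  imports
    "HOL-Complex_Analysis.Complex_Analysis"
    "HOL-Algebra.Generated_Groups"
    "HOL-Number_Theory.Cong"
begin

definition theta4 :: "complex \<Rightarrow> complex" where
  "theta4 q = (\<Sum>\<^sub>\<infinity>k::int. (-1) powi k * q powi (k\<^sup>2))"

definition mat2 :: "'a::zero \<Rightarrow> 'a \<Rightarrow> 'a \<Rightarrow> 'a \<Rightarrow> 'a^2^2" where
  "mat2 a b c d = vector [vector [a, b], vector [c, d]]"

text \<open>
  The entry \<open>q d\<vartheta>\<^sub>4(q\<^sup>l)/dq\<close> is the derivative of the composite \<open>x \<mapsto> \<vartheta>\<^sub>4(x\<^sup>l)\<close> at \<open>q\<close>.
\<close>

definition Dhat :: "nat \<Rightarrow> complex \<Rightarrow> complex" where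
  "Dhat l q =
     1 / (theta4 q ^ 3 * theta4 (q ^ l) ^ 3) *
     det (mat2 (theta4 q)                (theta4 (q ^ l))
               (q * deriv theta4 q)      (q * deriv (\<lambda>x. theta4 (x ^ l)) q))"

definition omega :: "nat \<Rightarrow> nat" where
  "omega l = (if [l = 1] (mod 4) then 2 else 1)"

definition upper_half_plane :: "complex set" where
  "upper_half_plane = {\<tau>. Im \<tau> > 0}"

definition moebius_act :: "real^2^2 \<Rightarrow> complex \<Rightarrow> complex" where
  "moebius_act A \<tau> =
     (of_real (A$1$1) * \<tau> + of_real (A$1$2)) / (of_real (A$2$1) * \<tau> + of_real (A$2$2))"

definition SL2R :: "(real^2^2) monoid" where
  "SL2R = \<lparr>carrier = {A. det A = 1}, mult = (**), one = mat 1\<rparr>"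

definition SL2Z :: "(real^2^2) set" where
  "SL2Z = {mat2 (of_int a) (of_int b) (of_int c) (of_int d) | a b c d :: int. a * d - b * c = 1}"

definition Gamma0 :: "nat \<Rightarrow> (real^2^2) set" where
  "Gamma0 N = {mat2 (of_int a) (of_int b) (of_int c) (of_int d) | a b c d :: int.
     a * d - b * c = 1 \<and> [c = 0] (mod int N)}"

text \<open>All admissible choices of the matrix \<open>W\<^sub>e\<close> at level \<open>N\<close>.\<close>

definition Atkin_Lehner :: "nat \<Rightarrow> nat \<Rightarrow> (real^2^2) set" where
  "Atkin_Lehner N e = {W. e dvd N \<and> coprime (N div e) e \<and> det W = 1 \<and>
     (\<exists>a b c d :: int.
        W = mat2 (of_int a * sqrt (real e))               (of_int b / sqrt (real e))
                 (of_int c * real N / sqrt (real e))      (of_int d * sqrt (real e)))}"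

definition Gamma0_plus :: "nat \<Rightarrow> real^2^2 \<Rightarrow> (real^2^2) set" where
  "Gamma0_plus N W = generate SL2R (Gamma0 N \<union> {W})"

text \<open>
  Meromorphy at \<open>\<i>\<infinity>\<close>: near \<open>\<i>\<infinity>\<close> the function is a Laurent series with finite principal part
  in the local parameter \<open>exp (2\<pi>\<i>\<tau>/h)\<close>, for some width \<open>h\<close>.
\<close>

definition meromorphic_at_ii_inf :: "(complex \<Rightarrow> complex) \<Rightarrow> bool" where
  "meromorphic_at_ii_inf f \<longleftrightarrow>
     (\<exists>h::nat. h > 0 \<and> (\<exists>F B. F meromorphic_on {0} \<and>
        (\<forall>\<tau>. Im \<tau> > B \<longrightarrow> f \<tau> = F (exp (2 * of_real pi * \<i> * \<tau> / of_nat h)))))"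

text \<open>
  Intended for subgroups \<open>\<Gamma>\<close> of \<open>SL\<^sub>2(\<real>)\<close> that are commensurable with \<open>SL\<^sub>2(\<int>)\<close>, such as
  \<open>\<Gamma>\<^sub>0(N) + W\<^sub>e\<close>. The cusps of such a group are the points of \<open>\<rat> \<union> {\<infinity>}\<close>, that is, the points
  \<open>\<gamma>\<infinity>\<close> with \<open>\<gamma> \<in> SL\<^sub>2(\<int>)\<close>; hence the last condition, which is meromorphy at every cusp.
  Poles in the upper half-plane carry the value \<open>0\<close>, which makes pointwise invariance meaningful.
\<close>

definition modular_function_on :: "(real^2^2) set \<Rightarrow> (complex \<Rightarrow> complex) \<Rightarrow> bool" where
  "modular_function_on \<Gamma> f \<longleftrightarrow>
     f nicely_meromorphic_on upper_half_plane \<and>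
     (\<forall>A\<in>\<Gamma>. \<forall>\<tau>\<in>upper_half_plane. f (moebius_act A \<tau>) = f \<tau>) \<and>
     (\<forall>A\<in>SL2Z. meromorphic_at_ii_inf (\<lambda>\<tau>. f (moebius_act A \<tau>)))"

lemma mat2_nth [simp]:
  "mat2 a b c d $ 1 $ 1 = a" "mat2 a b c d $ 1 $ 2 = b"
  "mat2 a b c d $ 2 $ 1 = c" "mat2 a b c d $ 2 $ 2 = d"
  by (simp_all add: mat2_def)

lemma det_mat2: "det (mat2 a b c d) = a * d - b * (c :: 'a::comm_ring_1)"
  by (simp add: det_2)

lemma group_SL2R: "group SL2R"
proof (rule groupI)
  fix A assume "A \<in> carrier SL2R"
  hence A: "det A = 1" by (simp add: SL2R_def)
  hence "invertible A" by (simp add: invertible_det_nz)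
  then obtain B where B: "A ** B = mat 1" "B ** A = mat 1"
    by (auto simp: invertible_def)
  have "det B = 1" using A B(1) det_mul[of A B] by simp
  with B show "\<exists>y\<in>carrier SL2R. y \<otimes>\<^bsub>SL2R\<^esub> A = \<one>\<^bsub>SL2R\<^esub>"
    by (auto simp: SL2R_def)
qed (auto simp: SL2R_def det_mul matrix_mul_assoc)

lemma Gamma0_subset_SL2R: "Gamma0 N \<subseteq> carrier SL2R"
  by (auto simp: Gamma0_def SL2R_def det_mat2 simp flip: of_int_mult of_int_diff)

lemma Atkin_Lehner_subset_SL2R: "Atkin_Lehner N e \<subseteq> carrier SL2R"
  by (auto simp: Atkin_Lehner_def SL2R_def)

lemma Atkin_Lehner_nonempty:
  assumes "N > 0" "e dvd N" "coprime (N div e) e"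
  shows "Atkin_Lehner N e \<noteq> {}"
proof -
  obtain m where N: "N = e * m" using assms(2) by blast
  have e: "e > 0" and m: "N div e = m" using assms(1) N by auto
  have "coprime (int m) (int e)" using assms(3) m by simp
  then obtain x y where xy: "x * int m + y * int e = 1"
    using bezout_int[of "int m" "int e"] by auto
  define W where "W = mat2 (of_int y * sqrt (real e)) (of_int (-x) / sqrt (real e))
     (of_int 1 * real N / sqrt (real e)) (of_int 1 * sqrt (real e))"
  have "det W = of_int (x * int m + y * int e)"
    using e by (simp add: W_def det_mat2 N field_simps)
  hence "det W = 1" by (simp only: xy of_int_1)
  hence "W \<in> Atkin_Lehner N e"
    unfolding Atkin_Lehner_def using assms W_def by blast
  thus ?thesis by blast
qed

end

theory Submission
  imports Defs "HOL-Probability.Characteristic_Functions"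
begin

text \<open>
  Put \<open>G(\<tau>) = \<vartheta>\<^sub>4(e\<^bsup>2\<pi>i\<tau>\<^esup>)\<^sup>2\<close> and \<open>G\<^sub>l(\<tau>) = G(l\<tau>)\<close>. Then \<open>4\<pi>i D\<^sub>l = (G\<^sub>l/G)'/G\<^sub>l\<^sup>2\<close>, a Wronskian of
  two forms of weight 1 divided by a form of weight 4, which is antisymmetric in \<open>(G, G\<^sub>l)\<close>. On
  \<open>\<Gamma>\<^sub>0(2)\<close> the form \<open>G\<close> has an explicit multiplier with values in the fourth roots of unity, obtained
  from the inversion formula of the theta constants by descent along \<open>\<tau> \<mapsto> \<tau> + 1\<close> and
  \<open>\<tau> \<mapsto> \<tau>/(2\<tau> + 1)\<close>. On \<open>\<Gamma>\<^sub>0(2l)\<close> the multipliers of \<open>G\<close> and \<open>G\<^sub>l\<close> cancel up to a sign that is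
  \<open>1\<close> for \<open>l \<equiv> 3 (mod 4)\<close>; \<open>W\<^sub>l\<close> exchanges \<open>G\<close> and \<open>G\<^sub>l\<close>, and for \<open>l \<equiv> 3 (mod 4)\<close> the product of
  multipliers \<open>-1\<close> compensates the antisymmetry. At a cusp, \<open>G\<close> and \<open>G\<^sub>l\<close> become squares of theta
  constants at rational affine arguments, which are power series in a local parameter. The theta
  constants do not vanish on the upper half-plane, so there are no poles there.
\<close>

section \<open>Inversion of the real theta series\<close>

text \<open>Squares are used because \<open>theta4\<close> itself has weight 1/2: its inversion
  carries a branch of the square root, whereas the square only acquires the factor
  \<open>- \<i> * \<tau>\<close>. The root therefore survives no further than the two inversion
  formulas, and every later multiplier is a constant. The exponent \<open>omega l\<close>
  compensates such a constant: for l = 1 mod 4 the product of the two multipliers is -1 on matrices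
  of Gamma_0(2l) whose lower left entry is 2 mod 4, so the quotient changes sign there and has to be
  squared. Transformation laws are needed at two levels of precision. Invariance requires the exact
  fourth root of unity, hence a descent inside Gamma_0(2), where the form goes to a multiple of
  itself. The cusps require all of SL_2(Z), but there any nonzero constant will do, so the three
  theta squares are merely permuted with unspecified factors. The same permutation reduces
  zero-freeness to points high in the half-plane, which avoids the product formula.\<close>

lemma gaussian_cos_integral:
  fixes t m :: real
  assumes "t > 0"
  shows "integrable lborel (\<lambda>x. exp (- pi * t * x\<^sup>2) * cos (2 * pi * m * x))" (is ?I)
    and "(LINT x|lborel. exp (- pi * t * x\<^sup>2) * cos (2 * pi * m * x)) = exp (- pi * m\<^sup>2 / t) / sqrt t"
proof -
  \<comment> \<open>Substituting \<open>c * x\<close> in the standard normal density gives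
    \<open>exp (- pi * t * x\<^sup>2) / sqrt (2 * pi)\<close>, and \<open>u * c\<close> is the
    required frequency \<open>2 * pi * m\<close>. The integral is then the characteristic function
    at \<open>u\<close>.\<close>
  define c where "c = sqrt (2 * pi * t)"
  define u where "u = 2 * pi * m / c"
  have c: "c > 0" "c\<^sup>2 = 2 * pi * t" using assms by (simp_all add: c_def)
  interpret N: real_distribution std_normal_distribution
    by (rule real_dist_normal_dist)
  have int1: "integrable std_normal_distribution (\<lambda>x. iexp (u * x))"
    by (rule N.integrable_const_bound[where B = 1]) auto
  have "Re (char std_normal_distribution u) = exp (- u\<^sup>2 / 2)"
    by (simp add: char_std_normal_distribution)
  hence "(LINT x|std_normal_distribution. cos (u * x)) = exp (- u\<^sup>2 / 2)"
    using int1 by (simp add: char_def integral_Re[symmetric] Re_exp del: integral_Re)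
  moreover have "integrable std_normal_distribution (\<lambda>x. cos (u * x))"
    by (rule N.integrable_const_bound[where B = 1]) auto
  ultimately have I: "integrable lborel (\<lambda>x. std_normal_density x * cos (u * x))"
    "(LINT x|lborel. std_normal_density x * cos (u * x)) = exp (- u\<^sup>2 / 2)"
    by (simp_all add: integrable_density integral_density normal_density_nonneg)
  have eq: "std_normal_density (0 + c * x) * cos (u * (0 + c * x)) =
     exp (- pi * t * x\<^sup>2) * cos (2 * pi * m * x) / sqrt (2 * pi)" for x
    using c by (simp add: std_normal_density_def u_def power_mult_distrib field_simps)
  have "integrable lborel (\<lambda>x. exp (- pi * t * x\<^sup>2) * cos (2 * pi * m * x) / sqrt (2 * pi))"
    using lborel_integrable_real_affine[OF I(1), of c 0] c unfolding eq by simp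
  hence "integrable lborel (\<lambda>x. sqrt (2 * pi) * (exp (- pi * t * x\<^sup>2) * cos (2 * pi * m * x) / sqrt (2 * pi)))"
    by (rule integrable_mult_right)
  thus ?I by simp
  have "exp (- u\<^sup>2 / 2) = c * (LINT x|lborel. exp (- pi * t * x\<^sup>2) * cos (2 * pi * m * x) / sqrt (2 * pi))"
    using lborel_integral_real_affine[of c "\<lambda>x. std_normal_density x * cos (u * x)" 0] I c
    unfolding eq by simp
  moreover have "u\<^sup>2 / 2 = pi * m\<^sup>2 / t"
    using c assms by (simp add: u_def power_divide power2_eq_square)
  ultimately show "(LINT x|lborel. exp (- pi * t * x\<^sup>2) * cos (2 * pi * m * x)) = exp (- pi * m\<^sup>2 / t) / sqrt t"
    using c assms by (simp add: c_def real_sqrt_mult field_simps)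
qed

text \<open>The symmetry makes \<open>D\<close> a continuous function of
  \<open>cos (2 * pi * x)\<close>, so Weierstrass approximation on [-1, 1] yields a polynomial in
  that cosine uniformly close to \<open>D\<close>. Vanishing coefficients make \<open>D\<close>
  orthogonal to all such polynomials, hence to itself.\<close>

lemma cos_coeffs_zero_imp_zero:
  fixes D :: "real \<Rightarrow> real"
  assumes cont: "continuous_on {0..1} D"
    and sym: "\<And>x. x \<in> {0..1} \<Longrightarrow> D (1 - x) = D x"
    and coeff: "\<And>m::nat. integral {0..1} (\<lambda>x. D x * cos (2 * pi * m * x)) = 0"
    and x: "x \<in> {0..1}"
  shows "D x = 0"
proof -
  let ?c = "\<lambda>x. cos (2 * pi * x)"
  have ii: "(\<lambda>x. D x * h x) integrable_on {0..1}" if "continuous_on {0..1} h" for h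
    by (intro integrable_continuous_real continuous_intros cont that)
  have coeff_int: "integral {0..1} (\<lambda>x. D x * cos (2 * pi * of_int m * x)) = 0" for m :: int
  proof -
    have "cos (2 * pi * of_int m * x) = cos (2 * pi * nat \<bar>m\<bar> * x)" for x
      by (cases "m \<ge> 0") auto
    thus ?thesis using coeff[of "nat \<bar>m\<bar>"] by (simp only:)
  qed
  \<comment> \<open>The extra factor \<open>cos (2 * pi * of_int m * x)\<close> makes the induction
    go through: the product formula trades one power of the cosine for the frequencies
    \<open>m + 1\<close> and \<open>m - 1\<close>. Integer \<open>m\<close> is needed because
    \<open>m - 1\<close> may be negative.\<close>
  have pw: "integral {0..1} (\<lambda>x. D x * (cos (2 * pi * of_int m * x) * ?c x ^ i)) = 0" for m :: int and i
  proof (induction i arbitrary: m)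
    case (Suc i)
    have eq: "D x * (cos (2 * pi * of_int m * x) * ?c x ^ Suc i) =
      1/2 * (D x * (cos (2 * pi * of_int (m + 1) * x) * ?c x ^ i)
           + D x * (cos (2 * pi * of_int (m - 1) * x) * ?c x ^ i))" for x
    proof -
      have cc: "cos (2 * pi * of_int m * x) * ?c x =
        1/2 * (cos (2 * pi * of_int (m + 1) * x) + cos (2 * pi * of_int (m - 1) * x))"
        unfolding cos_times_cos by (simp add: algebra_simps)
      have "D x * (cos (2 * pi * of_int m * x) * ?c x ^ Suc i) =
        D x * (cos (2 * pi * of_int m * x) * ?c x) * ?c x ^ i" by simp
      also have "\<dots> = 1/2 * (D x * (cos (2 * pi * of_int (m + 1) * x) * ?c x ^ i)
           + D x * (cos (2 * pi * of_int (m - 1) * x) * ?c x ^ i))"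
        unfolding cc by (simp only: distrib_left distrib_right mult_ac)
      finally show ?thesis .
    qed
    show ?case unfolding eq
      by (subst integral_mult_right, subst integral_add)
         (auto intro!: ii continuous_intros simp: Suc.IH[of "m + 1", simplified] Suc.IH[of "m - 1", simplified])
  qed (use coeff_int in auto)
  have pw0: "integral {0..1} (\<lambda>x. D x * ?c x ^ i) = 0" for i using pw[of 0 i] by simp
  define M where "M = integral {0..1} (\<lambda>x. \<bar>D x\<bar>)"
  have M: "M \<ge> 0" unfolding M_def by (intro integral_nonneg integrable_continuous_real continuous_intros cont) auto
  have le: "integral {0..1} (\<lambda>x. (D x)\<^sup>2) \<le> e * M" if e: "e > 0" for e
  proof -
    have "continuous_on {-1..1} (\<lambda>y. D (arccos y / (2 * pi)))"
    proof (rule continuous_on_compose2[OF cont])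
      show "(\<lambda>y. arccos y / (2 * pi)) ` {-1..1} \<subseteq> {0..1}"
        by (auto simp: arccos_lbound intro!: order_trans[OF arccos_ubound])
    qed (auto intro!: continuous_intros)
    from Stone_Weierstrass_real_polynomial_function[OF _ this e] obtain g where
      g: "real_polynomial_function g" "\<And>y. y \<in> {-1..1} \<Longrightarrow> \<bar>D (arccos y / (2 * pi)) - g y\<bar> < e" by auto
    from g(1) obtain a n where ga: "g = (\<lambda>x. \<Sum>i\<le>n. a i * x ^ i)"
      unfolding real_polynomial_function_iff_sum by blast
    have gc: "continuous_on {0..1} (\<lambda>x. g (?c x))" unfolding ga by (intro continuous_intros)
    have half: "\<bar>D x - g (?c x)\<bar> < e" if "x \<in> {0..1/2}" for x
    proof -
      have "arccos (?c x) = 2 * pi * x" using that by (intro arccos_cos) auto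
      thus ?thesis using g(2)[of "?c x"] by simp
    qed
    have close: "\<bar>D x - g (?c x)\<bar> < e" if "x \<in> {0..1}" for x
    proof (cases "x \<le> 1/2")
      case False
      have "?c (1 - x) = ?c x" by (simp add: algebra_simps cos_diff)
      with half[of "1 - x"] sym[of x] that False show ?thesis by simp
    qed (use that half in auto)
    have "integral {0..1} (\<lambda>x. D x * g (?c x)) = integral {0..1} (\<lambda>x. \<Sum>i\<le>n. a i * (D x * ?c x ^ i))"
      unfolding ga by (simp add: sum_distrib_left mult_ac)
    also have "\<dots> = (\<Sum>i\<le>n. integral {0..1} (\<lambda>x. a i * (D x * ?c x ^ i)))"
      by (intro integral_sum integrable_on_mult_right ii continuous_intros) auto
    also have "\<dots> = 0" by (simp add: pw0)
    finally have z: "integral {0..1} (\<lambda>x. D x * g (?c x)) = 0" .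
    have "integral {0..1} (\<lambda>x. (D x)\<^sup>2) = integral {0..1} (\<lambda>x. (D x)\<^sup>2) - integral {0..1} (\<lambda>x. D x * g (?c x))"
      using z by simp
    also have "\<dots> = integral {0..1} (\<lambda>x. (D x)\<^sup>2 - D x * g (?c x))"
      by (intro integral_diff[symmetric] integrable_continuous_real continuous_intros cont gc)
    also have "\<dots> \<le> integral {0..1} (\<lambda>x. e * \<bar>D x\<bar>)"
    proof (intro integral_le integrable_continuous_real continuous_intros cont gc)
      fix x :: real assume x: "x \<in> {0..1}"
      have "(D x)\<^sup>2 - D x * g (?c x) \<le> \<bar>D x * (D x - g (?c x))\<bar>"
        by (simp add: power2_eq_square algebra_simps)
      also have "\<dots> = \<bar>D x - g (?c x)\<bar> * \<bar>D x\<bar>" by (simp add: abs_mult)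
      also have "\<dots> \<le> e * \<bar>D x\<bar>" using close[OF x] by (intro mult_right_mono) auto
      finally show "(D x)\<^sup>2 - D x * g (?c x) \<le> e * \<bar>D x\<bar>" .
    qed
    also have "\<dots> = e * M" unfolding M_def by simp
    finally show ?thesis .
  qed
  have "integral {0..1} (\<lambda>x. (D x)\<^sup>2) \<le> 0"
  proof (rule ccontr)
    \<comment> \<open>The choice \<open>e = X / (M + 1)\<close> gives X <= X M / (M + 1) < X; the
      summand 1 covers the case \<open>M = 0\<close>.\<close>
    define X where "X = integral {0..1} (\<lambda>x. (D x)\<^sup>2)"
    assume "\<not> integral {0..1} (\<lambda>x. (D x)\<^sup>2) \<le> 0"
    hence X: "X > 0" by (simp add: X_def)
    have "X \<le> X / (M + 1) * M" using le[of "X / (M + 1)"] X M by (simp add: X_def)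
    hence "X * (M + 1) \<le> X * M" using M by (simp add: pos_le_divide_eq)
    thus False using X by (simp add: distrib_left)
  qed
  moreover have "integral {0..1} (\<lambda>x. (D x)\<^sup>2) \<ge> 0"
    by (intro integral_nonneg integrable_continuous_real continuous_intros cont) auto
  ultimately have "integral {0..1} (\<lambda>x. (D x)\<^sup>2) = 0" by simp
  moreover have "continuous_on {0..1} (\<lambda>x. (D x)\<^sup>2)" by (intro continuous_intros cont)
  ultimately have "(D x)\<^sup>2 = 0"
    using x integral_eq_0_iff[of 0 1 "\<lambda>x. (D x)\<^sup>2"] by auto
  thus ?thesis by simp
qed


lemma integral_sums_Icc:
  fixes f :: "nat \<Rightarrow> real \<Rightarrow> real"
  assumes cont: "\<And>n. continuous_on {a..b} (f n)"
    and bound: "\<And>n x. x \<in> {a..b} \<Longrightarrow> \<bar>f n x\<bar> \<le> M n" and M: "summable M"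
  shows "continuous_on {a..b} (\<lambda>x. \<Sum>n. f n x)"
    and "(\<lambda>n. integral {a..b} (f n)) sums integral {a..b} (\<lambda>x. \<Sum>n. f n x)"
proof -
  have u: "uniform_limit {a..b} (\<lambda>n x. \<Sum>i<n. f i x) (\<lambda>x. \<Sum>n. f n x) sequentially"
    by (rule Weierstrass_m_test[OF _ M]) (use bound in auto)
  have c: "continuous_on {a..b} (\<lambda>x. \<Sum>i<n. f i x)" for n
    by (intro continuous_intros cont)
  show "continuous_on {a..b} (\<lambda>x. \<Sum>n. f n x)"
    by (rule uniform_limit_theorem[OF _ u]) (use c in auto)
  obtain I J where IJ: "\<And>n. ((\<lambda>x. \<Sum>i<n. f i x) has_integral I n) {a..b}"
    "((\<lambda>x. \<Sum>n. f n x) has_integral J) {a..b}" "I \<longlonglongrightarrow> J"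
    using uniform_limit_integral[OF u c] by auto
  have "I n = (\<Sum>i<n. integral {a..b} (f i))" for n
    using integral_unique[OF IJ(1)[of n]] integral_sum[of "{..<n}" f "{a..b}"]
    by (simp add: integrable_continuous_real cont)
  hence "I = (\<lambda>n. \<Sum>i<n. integral {a..b} (f i))" by blast
  with IJ(3) integral_unique[OF IJ(2)]
  show "(\<lambda>n. integral {a..b} (f n)) sums integral {a..b} (\<lambda>x. \<Sum>n. f n x)"
    by (simp add: sums_def)
qed

lemma integral_cos_int:
  fixes j :: int
  shows "integral {0..1} (\<lambda>x. cos (2 * pi * of_int j * x)) = (if j = 0 then 1 else (0::real))"
proof (cases "j = 0")
  case False
  have "((\<lambda>x. cos (2 * pi * of_int j * x)) has_integral
     sin (2 * pi * of_int j * 1) / (2 * pi * of_int j) - sin (2 * pi * of_int j * 0) / (2 * pi * of_int j)) {0..1}"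
    using False by (intro fundamental_theorem_of_calculus)
      (auto intro!: derivative_eq_intros simp flip: has_real_derivative_iff_has_vector_derivative)
  moreover have "sin (2 * pi * of_int j) = 0" using sin_int_2pin[of j] by simp
  ultimately show ?thesis using False by (auto dest: integral_unique)
qed auto

lemma integral_cos_cos_nat:
  fixes k m :: nat
  assumes "k > 0"
  shows "integral {0..1} (\<lambda>x. cos (2 * pi * k * x) * cos (2 * pi * m * x)) = (if k = m then 1/2 else (0::real))"
proof -
  have "cos (2 * pi * k * x) * cos (2 * pi * m * x) =
     1/2 * (cos (2 * pi * of_int (int k - int m) * x) + cos (2 * pi * of_int (int k + int m) * x))" for x
    unfolding cos_times_cos by (simp add: algebra_simps)
  hence "integral {0..1} (\<lambda>x. cos (2 * pi * k * x) * cos (2 * pi * m * x)) =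
    1/2 * (integral {0..1} (\<lambda>x. cos (2 * pi * of_int (int k - int m) * x))
         + integral {0..1} (\<lambda>x. cos (2 * pi * of_int (int k + int m) * x)))"
    by (simp only:) (subst integral_mult_right, subst integral_add,
        auto intro!: integrable_continuous_real continuous_intros)
  thus ?thesis using assms unfolding integral_cos_int by auto
qed

lemma summable_exp_neg: "c > 0 \<Longrightarrow> summable (\<lambda>n::nat. exp (- c * real n))"
proof -
  assume "c > 0"
  hence "summable (\<lambda>n. exp (- c) ^ n)" by (intro summable_geometric) auto
  thus ?thesis by (simp add: exp_of_nat2_mult[symmetric] mult.commute)
qed

text \<open>
  Both sides, divided by \<open>sqrt t\<close>, are values at \<open>0\<close> of continuous 1-periodic even functions: the
  periodised Gaussian and a cosine series. Their Fourier coefficients agree by the Gaussian integral.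
\<close>

lemma theta_real_inversion:
  fixes t :: real
  assumes t: "t > 0"
  shows "1 + 2 * (\<Sum>n. exp (- pi / t * (real n + 1)\<^sup>2)) =
         sqrt t * (1 + 2 * (\<Sum>n. exp (- pi * t * (real n + 1)\<^sup>2)))"
proof -
  define \<phi> where "\<phi> = (\<lambda>x. exp (- pi * t * x\<^sup>2))"
  \<comment> \<open>The periodised Gaussian over all integers, folded to a series over the naturals:
    \<open>1 - x + n\<close> is the negative of \<open>x - (n + 1)\<close>, and
    \<open>\<phi>\<close> is even.\<close>
  define f where "f = (\<lambda>(n::nat) x. \<phi> (x + n) + \<phi> (1 - x + n))"
  define F where "F = (\<lambda>x. \<Sum>n. f n x)"
  define g where "g = (\<lambda>(n::nat) x. 2 * exp (- pi / t * (real n + 1)\<^sup>2) * cos (2 * pi * (n + 1) * x))"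
  define G where "G = (\<lambda>x. (1 + (\<Sum>n. g n x)) / sqrt t)"
  have phi_pos: "\<phi> x > 0" for x by (simp add: \<phi>_def)
  have phi_le: "\<phi> y \<le> exp (- (pi * t) * real n)" if "y \<ge> real n" for y n
  proof -
    have "real n \<le> real n ^ 2" by (cases n) (auto simp: power2_eq_square)
    also have "\<dots> \<le> y\<^sup>2" using that by (intro power_mono) auto
    finally show ?thesis using t by (simp add: \<phi>_def)
  qed
  have f_le: "\<bar>f n x\<bar> \<le> 2 * exp (- (pi * t) * real n)" if "x \<in> {0..1}" for n x
    using phi_le[of n "x + n"] phi_le[of n "1 - x + n"] phi_pos[of "x + n"] phi_pos[of "1 - x + n"] that
    by (simp add: f_def)
  have g_le: "\<bar>g n x\<bar> \<le> 2 * exp (- (pi / t) * real n)" for n x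
  proof -
    have "real n \<le> (real n + 1)\<^sup>2" by (simp add: power2_eq_square algebra_simps)
    hence "exp (- pi / t * (real n + 1)\<^sup>2) \<le> exp (- (pi / t) * real n)" using t by (simp add: divide_right_mono mult_left_mono)
    moreover have "\<bar>cos (2 * pi * (n + 1) * x)\<bar> \<le> 1" by simp
    ultimately have "exp (- pi / t * (real n + 1)\<^sup>2) * \<bar>cos (2 * pi * (n + 1) * x)\<bar> \<le> exp (- (pi / t) * real n) * 1"
      by (intro mult_mono) auto
    thus ?thesis by (simp add: g_def abs_mult)
  qed
  have smf: "summable (\<lambda>n. 2 * exp (- (pi * t) * real n))" and smg: "summable (\<lambda>n. 2 * exp (- (pi / t) * real n))"
    using t by (intro summable_mult summable_exp_neg; simp)+
  have fc: "continuous_on A (f n)" and gc: "continuous_on A (g n)" for n A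
    unfolding f_def g_def \<phi>_def by (intro continuous_intros)+
  have Fc: "continuous_on {0..1} F" unfolding F_def
    by (rule integral_sums_Icc(1)[OF fc f_le smf])
  have Gc: "continuous_on {0..1} G" unfolding G_def
    by (intro continuous_intros integral_sums_Icc(1)[OF gc g_le smg]) (use t in auto)
  have sf: "summable (\<lambda>n. f n x)" if "x \<in> {0..1}" for x
    by (rule summable_comparison_test'[OF smf]) (use f_le that in auto)
  have sg: "summable (\<lambda>n. g n x)" for x
    by (rule summable_comparison_test'[OF smg]) (use g_le in auto)
  have mult_cos: "\<bar>y * cos z\<bar> \<le> B" if "\<bar>y\<bar> \<le> B" for y z B :: real
    using mult_mono[OF that abs_cos_le_one[of z]] that by (simp add: abs_mult)
  have Fcoeff: "integral {0..1} (\<lambda>x. F x * cos (2 * pi * m * x)) = exp (- pi * m\<^sup>2 / t) / sqrt t" for m :: nat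
  proof -
    define h where "h = (\<lambda>x. \<phi> x * cos (2 * pi * m * x))"
    have hc: "continuous_on A h" for A unfolding h_def \<phi>_def by (intro continuous_intros)
    have h_shift: "h (x + real n) = \<phi> (x + real n) * cos (2 * pi * m * x)" for n x
    proof -
      have "cos (2 * pi * m * (x + real n)) = cos (2 * pi * m * x + 2 * of_int (m * n) * pi)"
        by (simp add: algebra_simps)
      also have "\<dots> = cos (2 * pi * m * x)"
        using cos_int_2pin[of "int (m * n)"] sin_int_2pin[of "int (m * n)"]
        by (simp add: cos_add mult_ac)
      finally show ?thesis by (simp add: h_def)
    qed
    have int1: "((\<lambda>x. \<phi> (x + n) * cos (2 * pi * m * x)) has_integral integral {real n..real n + 1} h) {0..1}" for n :: nat
    proof -
      have "(h has_integral integral {real n..real n + 1} h) {0 + real n..1 + real n}"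
        using integrable_integral[OF integrable_continuous_real[OF hc]] by (simp add: add.commute)
      hence "((h \<circ> (+) (real n)) has_integral integral {real n..real n + 1} h) {0..1}"
        by (subst has_integral_shift_Icc_real)
      thus ?thesis by (simp add: o_def h_shift add.commute)
    qed
    have int2: "((\<lambda>x. \<phi> (1 - x + n) * cos (2 * pi * m * x)) has_integral integral {real n..real n + 1} h) {0..1}" for n :: nat
    proof -
      have "((\<lambda>x. \<phi> (- x + n) * cos (2 * pi * m * (- x))) has_integral integral {real n..real n + 1} h) {-1..-0}"
        using int1[of n] by (subst has_integral_reflect_real)
      hence "((\<lambda>x. \<phi> (- x + n) * cos (2 * pi * m * x)) has_integral integral {real n..real n + 1} h) {0 + (-1)..1 + (-1)}"
        by simp
      hence "(((\<lambda>x. \<phi> (- x + n) * cos (2 * pi * m * x)) \<circ> (+) (-1)) has_integral integral {real n..real n + 1} h) {0..1}"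
        by (subst has_integral_shift_Icc_real)
      moreover have "cos (2 * pi * m * (x - 1)) = cos (2 * pi * m * x)" for x
        using cos_int_2pin[of "int m"] sin_int_2pin[of "int m"]
        by (simp add: right_diff_distrib cos_diff mult_ac)
      moreover have "- (x - 1) + real n = 1 - x + n" for x by simp
      ultimately show ?thesis by (simp only: o_def add.commute[of "-1"] diff_conv_add_uminus)
    qed
    \<comment> \<open>Both halves of \<open>f n\<close> unfold to the same integral of the even
      function \<open>h\<close>, so the partial sums are integrals over growing symmetric intervals
      and tend to the Gaussian integral over the line.\<close>
    have fint: "integral {0..1} (\<lambda>x. f n x * cos (2 * pi * m * x)) = 2 * integral {real n..real n + 1} h" for n
      using integral_unique[OF has_integral_add[OF int1[of n] int2[of n]]] by (simp add: f_def distrib_right)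
    have "(\<lambda>n. integral {0..1} (\<lambda>x. f n x * cos (2 * pi * m * x))) sums
       integral {0..1} (\<lambda>x. \<Sum>n. f n x * cos (2 * pi * m * x))"
      by (rule integral_sums_Icc(2)[OF _ mult_cos[OF f_le] smf]) (auto intro!: continuous_intros fc)
    also have "integral {0..1} (\<lambda>x. \<Sum>n. f n x * cos (2 * pi * m * x)) = integral {0..1} (\<lambda>x. F x * cos (2 * pi * m * x))"
      unfolding F_def by (intro integral_cong suminf_mult2[symmetric] sf)
    finally have "(\<lambda>N. \<Sum>n<N. 2 * integral {real n..real n + 1} h) \<longlonglongrightarrow> integral {0..1} (\<lambda>x. F x * cos (2 * pi * m * x))"
      unfolding sums_def fint .
    moreover have "(\<Sum>n<N. 2 * integral {real n..real n + 1} h) = integral {-real N..real N} h" for N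
    proof -
      have A: "(\<Sum>n<N. integral {real n..real n + 1} h) = integral {0..real N} h"
      proof (induction N)
        case (Suc N)
        have "integral {0..real N} h + integral {real N..real (Suc N)} h = integral {0..real (Suc N)} h"
          by (intro Henstock_Kurzweil_Integration.integral_combine integrable_continuous_real hc) auto
        thus ?case using Suc by (simp add: add.commute)
      qed auto
      have "h (-x) = h x" for x by (simp add: h_def \<phi>_def)
      hence "integral {-real N..0} h = integral {0..real N} h"
        using Henstock_Kurzweil_Integration.integral_reflect_real[of "real N" 0 h] by simp
      moreover have "integral {-real N..0} h + integral {0..real N} h = integral {-real N..real N} h"
        by (intro Henstock_Kurzweil_Integration.integral_combine integrable_continuous_real hc) auto
      ultimately show ?thesis using A by (simp flip: sum_distrib_left)
    qed
    moreover have "(\<lambda>N. integral {-real N..real N} h) \<longlonglongrightarrow> exp (- pi * m\<^sup>2 / t) / sqrt t"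
    proof -
      have hi: "integrable lborel h" "(LINT x|lborel. h x) = exp (- pi * m\<^sup>2 / t) / sqrt t"
        using gaussian_cos_integral[OF t, of m] by (auto simp: h_def \<phi>_def)
      have hm: "h \<in> borel_measurable lborel" using hi(1) by auto
      have "(\<lambda>N. LINT x|lborel. indicator {-real N..real N} x *\<^sub>R h x) \<longlonglongrightarrow> (LINT x|lborel. h x)"
      proof (rule integral_dominated_convergence[where w = "\<lambda>x. norm (h x)"])
        show "AE x in lborel. (\<lambda>N. indicator {-real N..real N} x *\<^sub>R h x) \<longlonglongrightarrow> h x"
        proof (rule AE_I2)
          fix x :: real
          have "eventually (\<lambda>N. \<bar>x\<bar> \<le> real N) sequentially"
            using filterlim_real_sequentially by (auto simp: filterlim_at_top)
          hence "eventually (\<lambda>N. indicator {-real N..real N} x *\<^sub>R h x = h x) sequentially"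
            by eventually_elim (auto simp: indicator_def)
          thus "(\<lambda>N. indicator {-real N..real N} x *\<^sub>R h x) \<longlonglongrightarrow> h x"
            by (rule tendsto_eventually)
        qed
      qed (use hi hm in \<open>auto simp: indicator_def\<close>)
      moreover have "(LINT x|lborel. indicator {-real N..real N} x *\<^sub>R h x) = integral {-real N..real N} h" for N
        using set_borel_integral_eq_integral(2)[of "{-real N..real N}" h]
          integrable_mult_indicator[OF _ hi(1), of "{-real N..real N}"]
        by (simp add: set_lebesgue_integral_def set_integrable_def)
      ultimately show ?thesis using hi by simp
    qed
    ultimately show ?thesis by (simp add: LIMSEQ_unique)
  qed
  have Gcoeff: "integral {0..1} (\<lambda>x. G x * cos (2 * pi * m * x)) = exp (- pi * m\<^sup>2 / t) / sqrt t" for m :: nat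
  proof -
    have gint: "integral {0..1} (\<lambda>x. g n x * cos (2 * pi * m * x)) =
       (if n + 1 = m then exp (- pi * m\<^sup>2 / t) else 0)" for n
    proof -
      have "integral {0..1} (\<lambda>x. g n x * cos (2 * pi * m * x)) =
        2 * exp (- pi / t * (real n + 1)\<^sup>2) * integral {0..1} (\<lambda>x. cos (2 * pi * (n + 1) * x) * cos (2 * pi * m * x))"
        unfolding g_def by (subst integral_mult_right[symmetric]) (simp add: mult_ac)
      also have "\<dots> = (if n + 1 = m then exp (- pi * m\<^sup>2 / t) else 0)"
        by (subst integral_cos_cos_nat) auto
      finally show ?thesis .
    qed
    have "(\<lambda>n. integral {0..1} (\<lambda>x. g n x * cos (2 * pi * m * x))) sums
       integral {0..1} (\<lambda>x. \<Sum>n. g n x * cos (2 * pi * m * x))"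
      by (rule integral_sums_Icc(2)[OF _ mult_cos[OF g_le] smg]) (auto intro!: continuous_intros gc)
    \<comment> \<open>The series starts at frequency 1, so for \<open>m = 0\<close> it contributes
      nothing; that coefficient comes from the constant 1 in \<open>G\<close>.\<close>
    moreover have "(\<lambda>n. if n + 1 = m then exp (- pi * m\<^sup>2 / t) else 0) sums
       (if m = 0 then 0 else exp (- pi * m\<^sup>2 / t))"
    proof (cases m)
      case (Suc k)
      thus ?thesis using sums_single[of k "\<lambda>_. exp (- pi * m\<^sup>2 / t)"] by (auto simp: eq_commute)
    qed auto
    ultimately have S: "integral {0..1} (\<lambda>x. \<Sum>n. g n x * cos (2 * pi * m * x)) =
       (if m = 0 then 0 else exp (- pi * m\<^sup>2 / t))"
      unfolding gint using sums_unique2 by blast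
    have "integral {0..1} (\<lambda>x. G x * cos (2 * pi * m * x)) =
      integral {0..1} (\<lambda>x. (cos (2 * pi * of_int (int m) * x) + (\<Sum>n. g n x * cos (2 * pi * m * x))) * (1 / sqrt t))"
      by (simp add: G_def suminf_mult2[OF sg, symmetric] add_divide_distrib distrib_right)
    also have "\<dots> = (integral {0..1} (\<lambda>x. cos (2 * pi * of_int (int m) * x)) +
        integral {0..1} (\<lambda>x. \<Sum>n. g n x * cos (2 * pi * m * x))) * (1 / sqrt t)"
      by (subst integral_mult_left, subst integral_add)
        (auto intro!: integrable_continuous_real continuous_intros integral_sums_Icc(1)[OF _ mult_cos[OF g_le] smg] gc)
    also have "\<dots> = exp (- pi * m\<^sup>2 / t) / sqrt t"
      unfolding S integral_cos_int by simp
    finally show ?thesis .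
  qed
  have "F 0 - G 0 = 0"
  proof (rule cos_coeffs_zero_imp_zero[where D = "\<lambda>x. F x - G x"])
    show "continuous_on {0..1} (\<lambda>x. F x - G x)" by (intro continuous_intros Fc Gc)
    show "F (1 - x) - G (1 - x) = F x - G x" for x
    proof -
      have "f n (1 - x) = f n x" for n by (simp add: f_def)
      moreover have "cos (2 * pi * (n + 1) * (1 - x)) = cos (2 * pi * (n + 1) * x)" for n :: nat
      proof -
        have "2 * pi * (n + 1) * (1 - x) = 2 * pi * of_int (int (n + 1)) - 2 * pi * (n + 1) * x"
          by (simp add: algebra_simps)
        thus ?thesis by (simp only: cos_diff cos_int_2pin sin_int_2pin mult_1 mult_zero_left add_0_right)
      qed
      hence "g n (1 - x) = g n x" for n by (simp add: g_def)
      ultimately show ?thesis by (simp add: F_def G_def)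
    qed
    show "integral {0..1} (\<lambda>x. (F x - G x) * cos (2 * pi * m * x)) = 0" for m :: nat
      by (simp only: left_diff_distrib) (subst integral_diff,
        auto intro!: integrable_continuous_real continuous_intros Fc Gc simp: Fcoeff Gcoeff)
  qed auto
  hence FG: "F 0 = G 0" by simp
  define a where "a = (\<lambda>n::nat. exp (- pi * t * (real n + 1)\<^sup>2))"
  have f0: "f n 0 = \<phi> n + a n" for n by (simp add: f_def a_def \<phi>_def add.commute)
  have sa: "summable a"
  proof (rule summable_comparison_test'[OF smf])
    fix n
    have "a n > 0" by (simp add: a_def)
    thus "norm (a n) \<le> 2 * exp (- (pi * t) * real n)"
      using f_le[of 0 n] phi_pos[of "real n"] by (simp add: f0)
  qed
  have "(\<lambda>n. \<phi> n) sums (\<phi> 0 + suminf a)"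
  proof -
    have "(\<lambda>n. \<phi> (real (Suc n))) sums suminf a"
      using summable_sums[OF sa] by (simp add: a_def \<phi>_def add.commute)
    from sums_Suc[OF this] show ?thesis by (simp add: add.commute)
  qed
  from sums_add[OF this summable_sums[OF sa]] have "F 0 = \<phi> 0 + suminf a + suminf a"
    unfolding F_def f0 by (rule sums_unique[symmetric])
  hence "F 0 = 1 + 2 * suminf a" by (simp add: \<phi>_def)
  moreover have "G 0 = (1 + 2 * (\<Sum>n. exp (- pi / t * (real n + 1)\<^sup>2))) / sqrt t"
  proof -
    have "summable (\<lambda>n. exp (- pi / t * (real n + 1)\<^sup>2))"
      using summable_mult[OF sg[of 0], of "1/2"] by (simp add: g_def)
    thus ?thesis by (simp add: G_def g_def suminf_mult)
  qed
  ultimately show ?thesis using FG t by (simp add: a_def field_simps)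
qed

section \<open>Theta constants\<close>

text \<open>Folding k and -k in the bilateral series leaves an ordinary power series on the unit
  disc, ready for substitution of any local parameter. The index shift \<open>n + 1\<close> starts
  it at the first nonzero square.\<close>

definition theta3_nome :: "complex \<Rightarrow> complex" where
  "theta3_nome q = 1 + 2 * (\<Sum>n. q ^ ((n + 1)\<^sup>2))"

text \<open>The factor \<open>q\<^bsup>1/4\<^esup>\<close> of \<open>\<theta>\<^sub>2\<close> is left out to keep a power series.\<close>

definition theta2_nome :: "complex \<Rightarrow> complex" where
  "theta2_nome q = 2 * (\<Sum>n. q ^ (n\<^sup>2 + n))"

lemma summable_power_strict_mono:
  fixes q :: complex
  assumes "strict_mono g" "norm q < 1"
  shows "summable (\<lambda>n. norm (q ^ g n))" "summable (\<lambda>n. q ^ g n)"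
proof -
  show "summable (\<lambda>n. norm (q ^ g n))"
  proof (rule summable_comparison_test')
    show "summable (\<lambda>n. norm q ^ n)" using assms by (intro summable_geometric) auto
    show "norm (norm (q ^ g n)) \<le> norm q ^ n" for n
      using strict_mono_imp_increasing[OF assms(1), of n] assms(2)
      by (simp add: norm_power power_decreasing)
  qed
  thus "summable (\<lambda>n. q ^ g n)" by (rule summable_norm_cancel)
qed

lemma strict_mono_squares: "strict_mono (\<lambda>n::nat. (n + 1)\<^sup>2)"
  by (rule strict_monoI_Suc) (simp add: power2_eq_square)

lemma strict_mono_pronic: "strict_mono (\<lambda>n::nat. n\<^sup>2 + n)"
  by (rule strict_monoI_Suc) (simp add: power2_eq_square)

text \<open>Filling the gaps with zero coefficients turns the series into a power series that
  converges throughout the disc.\<close>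

lemma holomorphic_lacunary_series:
  assumes g: "strict_mono g"
  shows "(\<lambda>q::complex. \<Sum>n. q ^ g n) holomorphic_on ball 0 1"
proof (rule power_series_holomorphic)
  fix q :: complex assume q: "q \<in> ball 0 1"
  let ?a = "\<lambda>m. if m \<in> range g then 1 else (0::complex)"
  have "(\<lambda>n. ?a (g n) * q ^ g n) sums (\<Sum>n. q ^ g n)"
    using summable_sums[OF summable_power_strict_mono(2)[OF g]] q by simp
  hence "(\<lambda>m. ?a m * q ^ m) sums (\<Sum>n. q ^ g n)"
    by (subst (asm) sums_mono_reindex[OF g, of "\<lambda>m. ?a m * q ^ m"]) auto
  thus "(\<lambda>m. ?a m * (q - 0) ^ m) sums (\<Sum>n. q ^ g n)" by simp
qed

lemma holomorphic_theta3_nome: "theta3_nome holomorphic_on ball 0 1"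
  unfolding theta3_nome_def[abs_def]
  by (intro holomorphic_intros holomorphic_lacunary_series strict_mono_squares)

lemma holomorphic_theta2_nome: "theta2_nome holomorphic_on ball 0 1"
  unfolding theta2_nome_def[abs_def]
  by (intro holomorphic_intros holomorphic_lacunary_series strict_mono_pronic)

lemma theta2_nome_minus [simp]: "theta2_nome (- q) = theta2_nome q"
proof -
  have "(- q) ^ (n\<^sup>2 + n) = q ^ (n\<^sup>2 + n)" for n :: nat
    by (rule power_minus_even) (simp add: power2_eq_square)
  thus ?thesis by (simp add: theta2_nome_def)
qed

text \<open>Since k and k^2 have the same parity, the sign is absorbed into \<open>(- q)\<close> to
  the power k^2; the positive and the negative indices then contribute equal sums.\<close>

lemma theta4_conv_theta3_nome:
  assumes q: "norm q < 1"
  shows "theta4 q = theta3_nome (- q)"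
proof -
  define f where "f = (\<lambda>k::int. (-1) powi k * q powi (k\<^sup>2))"
  define S where "S = (\<Sum>n. (- q) ^ ((n + 1)\<^sup>2))"
  have f_pow: "f k = (- q) ^ nat (k\<^sup>2)" for k
  proof -
    have "q powi (k\<^sup>2) = q ^ nat (k\<^sup>2)" by (simp add: power_int_def)
    moreover have "(-1 :: complex) powi k = (-1) ^ nat (k\<^sup>2)"
      by (cases "even k") (auto simp: even_nat_iff)
    ultimately show ?thesis by (simp add: f_def power_minus[of q])
  qed
  have S: "((\<lambda>n. (- q) ^ ((n + 1)\<^sup>2)) has_sum S) UNIV"
    unfolding S_def using summable_power_strict_mono[OF strict_mono_squares, of "- q"] q
    by (intro norm_summable_imp_has_sum) (auto intro: summable_sums)
  have sq: "nat ((1 + int n)\<^sup>2) = (n + 1)\<^sup>2" for n :: nat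
    by (metis add.commute nat_int of_nat_1 of_nat_add of_nat_power)
  have "(f has_sum S) {0<..}"
  proof -
    have "bij_betw (\<lambda>n::nat. 1 + int n) UNIV {0<..}"
      by (rule bij_betwI[of _ _ _ "\<lambda>k. nat (k - 1)"]) auto
    from has_sum_reindex_bij_betw[OF this, of f S] show ?thesis using S by (simp add: f_pow sq)
  qed
  moreover have "(f has_sum S) {..<0}"
  proof -
    have "bij_betw (\<lambda>n::nat. - (1 + int n)) UNIV {..<0}"
      by (rule bij_betwI[of _ _ _ "\<lambda>k. nat (- k - 1)"]) auto
    from has_sum_reindex_bij_betw[OF this, of f S] show ?thesis using S
      by (simp add: f_pow power2_minus sq del: minus_add_distrib)
  qed
  ultimately have "(f has_sum (S + S)) ({0<..} \<union> {..<0})"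
    by (intro has_sum_Un_disjoint) auto
  hence "(f has_sum (f 0 + (S + S))) (insert 0 ({0<..} \<union> {..<0}))"
    by (intro has_sum_insert) auto
  moreover have "insert 0 ({0<..} \<union> {..<0}) = (UNIV :: int set)" by auto
  ultimately have "(f has_sum (1 + 2 * S)) UNIV" by (simp add: f_def)
  thus ?thesis by (simp add: theta4_def f_def S_def theta3_nome_def infsumI)
qed

text \<open>Even squares are 4 k^2 and odd squares are 4 (k^2 + k) + 1, so the even part is again
  \<open>theta3_nome\<close> and the odd part is \<open>x\<close> times \<open>theta2_nome\<close>,
  both at \<open>x ^ 4\<close>.\<close>

lemma theta3_nome_split:
  assumes x: "norm x < 1"
  shows "theta3_nome x = theta3_nome (x ^ 4) + x * theta2_nome (x ^ 4)"
proof -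
  have x4: "norm (x ^ 4) < 1" using x by (simp add: norm_power power_less_one_iff)
  have A: "(\<lambda>n. x ^ ((2 * n + 2)\<^sup>2)) sums (\<Sum>n. (x ^ 4) ^ ((n + 1)\<^sup>2))"
  proof -
    have "(x ^ 4) ^ ((n + 1)\<^sup>2) = x ^ ((2 * n + 2)\<^sup>2)" for n :: nat
    proof -
      have "(2 * n + 2)\<^sup>2 = 4 * (n + 1)\<^sup>2" by (simp add: power2_eq_square)
      thus ?thesis by (simp only: power_mult)
    qed
    thus ?thesis using summable_sums[OF summable_power_strict_mono(2)[OF strict_mono_squares x4]] by simp
  qed
  have B: "(\<lambda>n. x ^ ((2 * n + 1)\<^sup>2)) sums (x * (\<Sum>n. (x ^ 4) ^ (n\<^sup>2 + n)))"
  proof -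
    have "x * (x ^ 4) ^ (n\<^sup>2 + n) = x ^ ((2 * n + 1)\<^sup>2)" for n :: nat
    proof -
      have "(2 * n + 1)\<^sup>2 = Suc (4 * (n\<^sup>2 + n))" by (simp add: power2_eq_square)
      thus ?thesis by (simp only: power_Suc power_mult)
    qed
    thus ?thesis using sums_mult[OF summable_sums[OF summable_power_strict_mono(2)[OF strict_mono_pronic x4]], of x] by simp
  qed
  \<comment> \<open>The summation index is one less than the base of the square, so even
    \<open>n\<close> carry the odd squares.\<close>
  let ?e = "\<lambda>n. if even n then x ^ ((n + 1)\<^sup>2) else 0" and ?o = "\<lambda>n. if odd n then x ^ ((n + 1)\<^sup>2) else 0"
  have "?e sums (x * (\<Sum>n. (x ^ 4) ^ (n\<^sup>2 + n)))"
  proof (subst sums_mono_reindex[of "\<lambda>n. 2 * n" ?e, symmetric])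
    show "(if even n then x ^ ((n + 1)\<^sup>2) else 0) = 0" if "n \<notin> range (\<lambda>n. 2 * n)" for n
      using that by (auto elim!: evenE)
  qed (use B in \<open>auto simp: strict_mono_def\<close>)
  moreover have "?o sums (\<Sum>n. (x ^ 4) ^ ((n + 1)\<^sup>2))"
  proof (subst sums_mono_reindex[of "\<lambda>n. 2 * n + 1" ?o, symmetric])
    show "(if odd n then x ^ ((n + 1)\<^sup>2) else 0) = 0" if "n \<notin> range (\<lambda>n. 2 * n + 1)" for n
      using that by (auto elim!: oddE)
  qed (use A in \<open>auto simp: strict_mono_def\<close>)
  ultimately have "(\<lambda>n. ?e n + ?o n) sums (x * (\<Sum>n. (x ^ 4) ^ (n\<^sup>2 + n)) + (\<Sum>n. (x ^ 4) ^ ((n + 1)\<^sup>2)))"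
    by (rule sums_add)
  moreover have "?e n + ?o n = x ^ ((n + 1)\<^sup>2)" for n by simp
  ultimately have "(\<lambda>n. x ^ ((n + 1)\<^sup>2)) sums (x * (\<Sum>n. (x ^ 4) ^ (n\<^sup>2 + n)) + (\<Sum>n. (x ^ 4) ^ ((n + 1)\<^sup>2)))"
    by (simp only:)
  from sums_unique[OF this, symmetric] show ?thesis
    unfolding theta3_nome_def theta2_nome_def by (simp only:) (simp add: distrib_left)
qed

definition nome :: "complex \<Rightarrow> complex" where "nome \<tau> = exp (of_real pi * \<i> * \<tau>)"

text \<open>The prefactor \<open>nome (\<tau> / 4)\<close> is a fourth root of the nome chosen
  holomorphically in \<open>\<tau>\<close>, so no branch cut enters.\<close>

definition theta2_const :: "complex \<Rightarrow> complex" where "theta2_const \<tau> = nome (\<tau> / 4) * theta2_nome (nome \<tau>)"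
definition theta3_const :: "complex \<Rightarrow> complex" where "theta3_const \<tau> = theta3_nome (nome \<tau>)"
definition theta4_const :: "complex \<Rightarrow> complex" where "theta4_const \<tau> = theta3_nome (- nome \<tau>)"

lemma norm_nome: "norm (nome \<tau>) = exp (- pi * Im \<tau>)"
  by (simp add: nome_def)

lemma norm_nome_less_1: "Im \<tau> > 0 \<Longrightarrow> norm (nome \<tau>) < 1"
  by (simp add: norm_nome)

lemma nome_nonzero [simp]: "nome \<tau> \<noteq> 0" by (simp add: nome_def)

lemma nome_add: "nome (\<tau> + \<sigma>) = nome \<tau> * nome \<sigma>"
  by (simp add: nome_def exp_add[symmetric] algebra_simps)

lemma nome_mult_of_nat: "nome (of_nat n * \<tau>) = nome \<tau> ^ n"
  by (simp add: nome_def exp_of_nat_mult[symmetric] algebra_simps)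

lemma nome_of_int: "nome (of_int n) = (if even n then 1 else -1)"
proof -
  have "nome (of_int n) = cis (pi * of_int n)" by (simp add: nome_def cis_conv_exp mult_ac)
  thus ?thesis by (simp add: complex_eq_iff)
qed

lemma holomorphic_nome [holomorphic_intros]: "f holomorphic_on A \<Longrightarrow> (\<lambda>z. nome (f z)) holomorphic_on A"
  unfolding nome_def by (intro holomorphic_intros)

lemma holomorphic_theta3_const: "theta3_const holomorphic_on upper_half_plane"
  unfolding theta3_const_def[abs_def]
  by (rule holomorphic_on_compose_gen[OF _ holomorphic_theta3_nome, unfolded o_def])
     (auto simp: upper_half_plane_def norm_nome_less_1 intro!: holomorphic_intros)

lemma holomorphic_theta4_const: "theta4_const holomorphic_on upper_half_plane"
  unfolding theta4_const_def[abs_def]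
  by (rule holomorphic_on_compose_gen[OF _ holomorphic_theta3_nome, unfolded o_def])
     (auto simp: upper_half_plane_def norm_nome_less_1 intro!: holomorphic_intros)

lemma open_upper_half_plane: "open upper_half_plane"
  unfolding upper_half_plane_def by (rule open_halfspace_Im_gt)

lemma connected_upper_half_plane: "connected upper_half_plane"
  unfolding upper_half_plane_def by (intro convex_connected convex_halfspace_Im_gt)

lemma Im_neg_inverse: "Im (- 1 / \<tau>) = Im \<tau> / (norm \<tau>)\<^sup>2"
  by (simp add: Im_divide cmod_power2)

lemma neg_inverse_in_upper_half_plane: "Im \<tau> > 0 \<Longrightarrow> Im (- 1 / \<tau>) > 0"
  unfolding Im_neg_inverse by (auto intro!: divide_pos_pos)

lemma theta3_const_ii_real:
  assumes "t > 0"
  shows "theta3_const (\<i> * of_real t) = of_real (1 + 2 * (\<Sum>n. exp (- pi * t * (real n + 1)\<^sup>2)))"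
proof -
  have n: "nome (\<i> * of_real t) = of_real (exp (- pi * t))"
    by (simp add: nome_def exp_of_real[symmetric] mult_ac)
  have pw: "nome (\<i> * of_real t) ^ ((n + 1)\<^sup>2) = of_real (exp (- pi * t * (real n + 1)\<^sup>2))" for n
  proof -
    have "exp (- pi * t) ^ ((n + 1)\<^sup>2) = exp (real ((n + 1)\<^sup>2) * (- pi * t))"
      by (rule exp_of_nat_mult[symmetric])
    also have "\<dots> = exp (- pi * t * (real n + 1)\<^sup>2)" by (simp add: mult_ac add_ac)
    finally show ?thesis unfolding n by (simp only: of_real_power[symmetric])
  qed
  have "summable (\<lambda>n. nome (\<i> * of_real t) ^ ((n + 1)\<^sup>2))"
    using summable_power_strict_mono[OF strict_mono_squares norm_nome_less_1[of "\<i> * of_real t"]] assms by simp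
  hence "summable (\<lambda>n. exp (- pi * t * (real n + 1)\<^sup>2))"
    unfolding pw by (simp only: summable_complex_of_real)
  hence "(\<Sum>n. nome (\<i> * of_real t) ^ ((n + 1)\<^sup>2)) = of_real (\<Sum>n. exp (- pi * t * (real n + 1)\<^sup>2))"
    unfolding pw by (rule suminf_of_real[symmetric])
  thus ?thesis by (simp add: theta3_const_def theta3_nome_def)
qed

text \<open>Both sides are holomorphic on the upper half-plane and agree on the imaginary axis by
  the real inversion formula, so the identity theorem applies. The principal root causes no trouble
  because \<open>- \<i> * \<tau>\<close> has positive real part.\<close>

lemma theta3_const_inversion:
  assumes "Im \<tau> > 0"
  shows "theta3_const (- 1 / \<tau>) = csqrt (- \<i> * \<tau>) * theta3_const \<tau>"
proof -
  let ?f = "\<lambda>\<tau>. theta3_const (- 1 / \<tau>) - csqrt (- \<i> * \<tau>) * theta3_const \<tau>"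
  have "?f \<tau> = 0"
  proof (rule analytic_continuation[of ?f upper_half_plane "(\<lambda>t. \<i> * of_real t) ` {0<..}" "\<i>"])
    have 1: "(\<lambda>\<tau>. theta3_const (- 1 / \<tau>)) holomorphic_on upper_half_plane"
      by (rule holomorphic_on_compose_gen[OF _ holomorphic_theta3_const, unfolded o_def])
         (auto simp: upper_half_plane_def neg_inverse_in_upper_half_plane[simplified] intro!: holomorphic_intros)
    show "?f holomorphic_on upper_half_plane"
      by (intro holomorphic_intros 1 holomorphic_theta3_const)
         (auto simp: upper_half_plane_def complex_nonpos_Reals_iff)
    show "\<i> islimpt (\<lambda>t. \<i> * of_real t) ` {0<..}"
      unfolding islimpt_approachable
    proof safe
      fix e :: real assume "e > 0"
      thus "\<exists>x'\<in>(\<lambda>t. \<i> * complex_of_real t) ` {0<..}. x' \<noteq> \<i> \<and> dist x' \<i> < e"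
        by (intro bexI[of _ "\<i> * of_real (1 + e / 2)"] conjI)
           (auto simp: dist_norm algebra_simps norm_mult complex_eq_iff)
    qed
    fix z assume "z \<in> (\<lambda>t. \<i> * complex_of_real t) ` {0<..}"
    then obtain t where z: "z = \<i> * of_real t" and t: "t > 0" by auto
    have "- 1 / z = \<i> * of_real (1 / t)" unfolding z using t by (simp add: field_simps)
    hence "theta3_const (- 1 / z) = of_real (1 + 2 * (\<Sum>n. exp (- pi / t * (real n + 1)\<^sup>2)))"
      using theta3_const_ii_real[of "1 / t"] t by simp
    also have "\<dots> = of_real (sqrt t) * theta3_const z"
      unfolding theta_real_inversion[OF t] z theta3_const_ii_real[OF t] by (rule of_real_mult)
    also have "of_real (sqrt t) = csqrt (- \<i> * z)" using t by (simp add: z csqrt_of_real_nonneg)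
    finally show "?f z = 0" by simp
  qed (use assms open_upper_half_plane connected_upper_half_plane in \<open>auto simp: upper_half_plane_def\<close>)
  thus ?thesis by simp
qed

text \<open>
  Splitting the exponents of \<open>\<theta>\<^sub>3\<close> by parity expresses \<open>\<theta>\<^sub>4\<close> and \<open>\<theta>\<^sub>2\<close> through \<open>\<theta>\<^sub>3\<close> at \<open>4\<tau>\<close> and \<open>\<tau>/4\<close>.
\<close>

lemma theta4_const_inversion:
  assumes \<tau>: "Im \<tau> > 0"
  shows "theta4_const (- 1 / \<tau>) = csqrt (- \<i> * \<tau>) * theta2_const \<tau>"
proof -
  \<comment> \<open>Adding the parity splittings at the nome and at its negative cancels the odd
    parts.\<close>
  have th4: "theta4_const \<sigma> = 2 * theta3_const (4 * \<sigma>) - theta3_const \<sigma>" if "Im \<sigma> > 0" for \<sigma>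
    using theta3_nome_split[of "nome \<sigma>"] theta3_nome_split[of "- nome \<sigma>"] norm_nome_less_1[OF that]
      nome_mult_of_nat[of 4 \<sigma>]
    by (simp add: theta4_const_def theta3_const_def)
  have th2: "theta2_const \<tau> = theta3_const (\<tau> / 4) - theta3_const \<tau>"
    using theta3_nome_split[of "nome (\<tau> / 4)"] norm_nome_less_1[of "\<tau> / 4"] \<tau> nome_mult_of_nat[of 4 "\<tau> / 4"]
    by (simp add: theta2_const_def theta3_const_def)
  have 4: "4 * (- 1 / \<tau>) = - 1 / (\<tau> / 4)" by simp
  have cs: "csqrt (- \<i> * (\<tau> / 4)) = csqrt (- \<i> * \<tau>) / 2"
  proof (rule csqrt_unique)
    show "(csqrt (- \<i> * \<tau>) / 2)\<^sup>2 = - \<i> * (\<tau> / 4)" by (simp add: power_divide)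
    show "0 < Re (csqrt (- \<i> * \<tau>) / 2) \<or> Re (csqrt (- \<i> * \<tau>) / 2) = 0 \<and> 0 \<le> Im (csqrt (- \<i> * \<tau>) / 2)"
      using csqrt_principal[of "- \<i> * \<tau>"] by (auto simp del: csqrt.simps)
  qed
  have "theta4_const (- 1 / \<tau>) = 2 * theta3_const (- 1 / (\<tau> / 4)) - theta3_const (- 1 / \<tau>)"
    using th4[OF neg_inverse_in_upper_half_plane[OF \<tau>]] unfolding 4 .
  also have "\<dots> = csqrt (- \<i> * \<tau>) * (theta3_const (\<tau> / 4) - theta3_const \<tau>)"
    using theta3_const_inversion[of "\<tau> / 4", unfolded cs] theta3_const_inversion[OF \<tau>] \<tau>
    by (simp add: algebra_simps)
  finally show ?thesis using th2 by simp
qed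

section \<open>Action of the modular group\<close>

text \<open>Positive determinant is the right generality: the Atkin-Lehner matrix is used later with
  integer entries and determinant \<open>l\<close>.\<close>

lemma moebius_upper_half_plane:
  fixes a b c d :: real
  assumes "a * d - b * c > 0" "Im \<tau> > 0"
  shows "of_real c * \<tau> + of_real d \<noteq> 0"
    and "Im ((of_real a * \<tau> + of_real b) / (of_real c * \<tau> + of_real d)) > 0"
proof -
  show nz: "of_real c * \<tau> + of_real d \<noteq> 0"
    using assms by (auto simp: complex_eq_iff)
  have "Im ((of_real a * \<tau> + of_real b) / (of_real c * \<tau> + of_real d)) =
    (a * d - b * c) * Im \<tau> / (norm (of_real c * \<tau> + of_real d))\<^sup>2"
    by (simp add: Im_divide cmod_power2 algebra_simps)
  also have "\<dots> > 0" using assms nz by (intro divide_pos_pos mult_pos_pos) auto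
  finally show "Im ((of_real a * \<tau> + of_real b) / (of_real c * \<tau> + of_real d)) > 0" .
qed

lemma moebius_upper_half_plane_int:
  fixes a b c d :: int
  assumes "a * d - b * c > 0" "Im \<tau> > 0"
  shows "of_int c * \<tau> + of_int d \<noteq> 0"
    and "Im ((of_int a * \<tau> + of_int b) / (of_int c * \<tau> + of_int d)) > 0"
proof -
  have "real_of_int a * of_int d - of_int b * of_int c > 0"
    using assms(1) by (simp flip: of_int_mult of_int_diff)
  from moebius_upper_half_plane[OF this assms(2)]
  show "of_int c * \<tau> + of_int d \<noteq> 0"
    and "Im ((of_int a * \<tau> + of_int b) / (of_int c * \<tau> + of_int d)) > 0" by simp_all
qed

text \<open>Up to nonzero factors this set is closed under translation by integers and under
  inversion, so a statement about all its members can be carried along a descent in SL_2(Z).\<close>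

definition theta_squares :: "(complex \<Rightarrow> complex) set" where
  "theta_squares = {\<lambda>\<tau>. (theta2_const \<tau>)\<^sup>2, \<lambda>\<tau>. (theta3_const \<tau>)\<^sup>2, \<lambda>\<tau>. (theta4_const \<tau>)\<^sup>2}"

lemma nome_shift: "nome (\<tau> + of_int n) = (if even n then nome \<tau> else - nome \<tau>)"
  by (simp add: nome_add nome_of_int)

lemma theta_squares_shift:
  assumes "U \<in> theta_squares"
  shows "\<exists>V\<in>theta_squares. \<exists>k. k \<noteq> 0 \<and> (\<forall>\<tau>. U (\<tau> + of_int n) = k * V \<tau>)"
proof -
  consider "U = (\<lambda>\<tau>. (theta2_const \<tau>)\<^sup>2)" | "U = (\<lambda>\<tau>. (theta3_const \<tau>)\<^sup>2)" | "U = (\<lambda>\<tau>. (theta4_const \<tau>)\<^sup>2)"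
    using assms by (auto simp: theta_squares_def)
  thus ?thesis
  proof cases
    case 1
    have "(theta2_const (\<tau> + of_int n))\<^sup>2 = (nome (of_int n / 4))\<^sup>2 * (theta2_const \<tau>)\<^sup>2" for \<tau>
      by (simp add: theta2_const_def add_divide_distrib nome_add[of "\<tau> / 4"] nome_shift power_mult_distrib)
    thus ?thesis by (intro bexI[of _ U] exI[of _ "(nome (of_int n / 4))\<^sup>2"]) (use 1 assms in auto)
  next
    case 2
    show ?thesis
      by (intro bexI[of _ "if even n then (\<lambda>\<tau>. (theta3_const \<tau>)\<^sup>2) else (\<lambda>\<tau>. (theta4_const \<tau>)\<^sup>2)"] exI[of _ 1])
        (auto simp: 2 theta3_const_def theta4_const_def nome_shift theta_squares_def)
  next
    case 3
    show ?thesis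
      by (intro bexI[of _ "if even n then (\<lambda>\<tau>. (theta4_const \<tau>)\<^sup>2) else (\<lambda>\<tau>. (theta3_const \<tau>)\<^sup>2)"] exI[of _ 1])
        (auto simp: 3 theta3_const_def theta4_const_def nome_shift theta_squares_def)
  qed
qed

lemma theta4_const_inversion_square:
  "Im \<tau> > 0 \<Longrightarrow> (theta4_const (- 1 / \<tau>))\<^sup>2 = - \<i> * \<tau> * (theta2_const \<tau>)\<^sup>2"
  by (simp only: theta4_const_inversion power_mult_distrib power2_csqrt)

lemma theta2_const_inversion_square:
  assumes "Im \<tau> > 0"
  shows "(theta2_const (- 1 / \<tau>))\<^sup>2 = - \<i> * \<tau> * (theta4_const \<tau>)\<^sup>2"
proof -
  have "\<tau> \<noteq> 0" using assms by auto
  moreover have "- 1 / (- 1 / \<tau>) = \<tau>" using \<open>\<tau> \<noteq> 0\<close> by simp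
  ultimately show ?thesis
    using theta4_const_inversion_square[OF neg_inverse_in_upper_half_plane[OF assms]] by (simp add: field_simps)
qed

lemma theta_squares_inversion:
  assumes "U \<in> theta_squares"
  shows "\<exists>V\<in>theta_squares. \<forall>\<tau>. Im \<tau> > 0 \<longrightarrow> U (- 1 / \<tau>) = - \<i> * \<tau> * V \<tau>"
proof -
  have theta3: "(theta3_const (- 1 / \<tau>))\<^sup>2 = - \<i> * \<tau> * (theta3_const \<tau>)\<^sup>2" if "Im \<tau> > 0" for \<tau>
    using that by (simp only: theta3_const_inversion power_mult_distrib power2_csqrt)
  consider "U = (\<lambda>\<tau>. (theta2_const \<tau>)\<^sup>2)" | "U = (\<lambda>\<tau>. (theta3_const \<tau>)\<^sup>2)" | "U = (\<lambda>\<tau>. (theta4_const \<tau>)\<^sup>2)"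
    using assms by (auto simp: theta_squares_def)
  thus ?thesis
  proof cases
    case 1
    show ?thesis
      by (rule bexI[of _ "\<lambda>\<tau>. (theta4_const \<tau>)\<^sup>2"]) (use 1 theta2_const_inversion_square in \<open>auto simp: theta_squares_def\<close>)
  next
    case 2
    show ?thesis
      by (rule bexI[of _ "\<lambda>\<tau>. (theta3_const \<tau>)\<^sup>2"]) (use 2 theta3 in \<open>auto simp: theta_squares_def\<close>)
  next
    case 3
    show ?thesis
      by (rule bexI[of _ "\<lambda>\<tau>. (theta2_const \<tau>)\<^sup>2"]) (use 3 theta4_const_inversion_square in \<open>auto simp: theta_squares_def\<close>)
  qed
qed

section \<open>Zero-freeness of the theta constants\<close>

text \<open>The exponents satisfy \<open>g n \<ge> Suc n\<close>, so a geometric series with sum |q|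
  / (1 - |q|) dominates. The value 1/3 is where this sum reaches 1/2, the size at which
  \<open>1 + 2 * (\<Sum>n. q ^ g n)\<close> could vanish.\<close>

lemma norm_lacunary_less_half:
  fixes q :: complex
  assumes g: "strict_mono g" "g 0 \<ge> 1" and q: "norm q < 1/3"
  shows "norm (\<Sum>n. q ^ g n) < 1/2"
proof -
  have q1: "norm q < 1" using q by simp
  have gn: "g n \<ge> Suc n" for n
  proof (induction n)
    case (Suc n)
    thus ?case using strict_monoD[OF g(1), of n "Suc n"] by simp
  qed (use g in simp)
  have gs: "(\<lambda>n. norm q * norm q ^ n) sums (norm q * (1 / (1 - norm q)))"
    using q1 by (intro sums_mult geometric_sums) auto
  have "norm (\<Sum>n. q ^ g n) \<le> (\<Sum>n. norm q * norm q ^ n)"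
  proof (rule norm_suminf_le)
    show "norm (q ^ g n) \<le> norm q * norm q ^ n" for n
      using power_decreasing[OF gn[of n], of "norm q"] q1 by (simp add: norm_power)
  qed (use gs in \<open>auto simp: sums_iff\<close>)
  also have "\<dots> = norm q / (1 - norm q)" using gs by (simp add: sums_iff)
  also have "\<dots> < 1/2" using q by (simp add: field_simps)
  finally show ?thesis .
qed

lemma theta3_nome_nonzero:
  assumes "norm q < 1/3"
  shows "theta3_nome q \<noteq> 0"
proof
  assume "theta3_nome q = 0"
  hence "(\<Sum>n. q ^ ((n + 1)\<^sup>2)) = - 1/2"
    by (simp add: theta3_nome_def) algebra
  hence "norm (\<Sum>n. q ^ ((n + 1)\<^sup>2)) = 1/2" by simp
  with norm_lacunary_less_half[OF strict_mono_squares _ assms] show False by simp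
qed

lemma theta2_nome_nonzero:
  assumes "norm q < 1/3"
  shows "theta2_nome q \<noteq> 0"
proof
  assume 0: "theta2_nome q = 0"
  have "summable (\<lambda>n. q ^ (n\<^sup>2 + n))"
    using assms by (intro summable_power_strict_mono strict_mono_pronic) auto
  from suminf_split_head[OF this] have "(\<Sum>n. q ^ ((Suc n)\<^sup>2 + Suc n)) = - 1"
    using 0 by (simp add: theta2_nome_def)
  moreover have "strict_mono (\<lambda>n. (Suc n)\<^sup>2 + Suc n)"
    by (rule strict_monoI_Suc) (simp add: power2_eq_square)
  ultimately show False using norm_lacunary_less_half[of "\<lambda>n. (Suc n)\<^sup>2 + Suc n" q] assms by simp
qed

text \<open>When \<open>\<bar>Re \<tau>\<bar> \<le> 1/2\<close> and \<open>Im \<tau> < 1/2\<close>, inversion at least doubles the imaginary part, so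
  shifts and inversions reach the region \<open>Im \<tau> \<ge> 1/2\<close>, where the series are dominated by their
  leading terms.\<close>

lemma theta_squares_nonzero:
  assumes "U \<in> theta_squares" "Im \<tau> > 0"
  shows "U \<tau> \<noteq> 0"
proof -
  \<comment> \<open>The induction counts the doublings that bring the imaginary part up to 1/2;
    \<open>U\<close> is generalised because each step permutes the theta squares.\<close>
  have "U \<tau> \<noteq> 0" if "U \<in> theta_squares" "Im \<tau> > 0" "Im \<tau> \<ge> 1 / 2 ^ Suc n" for n U \<tau>
    using that
  proof (induction n arbitrary: U \<tau>)
    case 0
    \<comment> \<open>For imaginary part at least 1/2 the nome has norm at most
      \<open>exp (- pi / 2)\<close>. The Taylor bound with pi > 3 gives exp (pi / 2) > 1 + 3/2 + 9/8
      > 3, which is the threshold 1/3.\<close>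
    have "exp (pi / 2) \<ge> 1 + pi / 2 + (pi / 2)\<^sup>2 / 2"
      using exp_lower_Taylor_quadratic[of "pi / 2"] by simp
    moreover have "1 + pi / 2 + (pi / 2)\<^sup>2 / 2 > 3"
      using pi_gt3 power_strict_mono[of "3/2" "pi/2" 2] by (simp add: power2_eq_square)
    ultimately have "exp (- pi / 2) < 1/3"
      by (simp add: exp_minus field_simps)
    moreover have "exp (- pi * Im \<tau>) \<le> exp (- pi / 2)" using 0 by simp
    ultimately have "norm (nome \<tau>) < 1/3" unfolding norm_nome by linarith
    hence "theta3_const \<tau> \<noteq> 0" "theta4_const \<tau> \<noteq> 0" "theta2_const \<tau> \<noteq> 0"
      by (auto simp: theta3_const_def theta4_const_def theta2_const_def theta3_nome_nonzero theta2_nome_nonzero)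
    thus ?case using 0 by (auto simp: theta_squares_def)
  next
    case (Suc n)
    show ?case
    proof (cases "Im \<tau> \<ge> 1 / 2 ^ Suc n")
      case False
      define m where "m = round (Re \<tau>)"
      define \<sigma> where "\<sigma> = \<tau> - of_int m"
      have \<sigma>: "Im \<sigma> = Im \<tau>" "\<bar>Re \<sigma>\<bar> \<le> 1/2"
        using of_int_round_abs_le[of "Re \<tau>"] by (simp_all add: \<sigma>_def m_def abs_minus_commute)
      obtain V k where V: "V \<in> theta_squares" "k \<noteq> 0" "\<And>z. U (z + of_int m) = k * V z"
        using theta_squares_shift[OF Suc.prems(1)] by blast
      obtain X where X: "X \<in> theta_squares" "\<And>z. Im z > 0 \<Longrightarrow> V (- 1 / z) = - \<i> * z * X z"
        using theta_squares_inversion[OF V(1)] by blast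
      have inv: "Im (- 1 / \<sigma>) > 0" using \<sigma> Suc.prems(2) neg_inverse_in_upper_half_plane[of \<sigma>] by simp
      have "Im \<tau> \<le> 1/2" 
      proof -
        have "(1::real) / 2 ^ Suc n \<le> 1/2" by (simp add: field_simps)
        with False show ?thesis by linarith
      qed
      hence "(norm \<sigma>)\<^sup>2 \<le> 1/2"
        using \<sigma> Suc.prems(2) power_mono[of "\<bar>Re \<sigma>\<bar>" "1/2" 2] power_mono[of "Im \<sigma>" "1/2" 2]
        unfolding cmod_power2 by (simp add: power2_eq_square)
      moreover have "\<sigma> \<noteq> 0" using \<sigma> Suc.prems(2) by auto
      ultimately have "Im (- 1 / \<sigma>) \<ge> 2 * Im \<tau>"
        unfolding Im_neg_inverse \<sigma> using Suc.prems(2)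
        by (subst pos_le_divide_eq) (auto simp: mult_le_cancel_left1)
      moreover have "2 * Im \<tau> \<ge> 1 / 2 ^ Suc n" using Suc.prems(3) by (simp add: field_simps)
      ultimately have "Im (- 1 / \<sigma>) \<ge> 1 / 2 ^ Suc n" by linarith
      \<comment> \<open>Inverting once more at \<open>- 1 / \<sigma>\<close> leads back to
        \<open>\<sigma>\<close>, so nonvanishing of \<open>X\<close> at the higher point transfers
        to \<open>V\<close> at \<open>\<sigma>\<close>.\<close>
      from Suc.IH[OF X(1) inv this] have "X (- 1 / \<sigma>) \<noteq> 0" .
      hence "V (- 1 / (- 1 / \<sigma>)) \<noteq> 0" using X(2)[OF inv] \<open>\<sigma> \<noteq> 0\<close> by simp
      hence "V \<sigma> \<noteq> 0" by simp
      thus ?thesis using V(2) V(3)[of \<sigma>] by (simp add: \<sigma>_def)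
    qed (use Suc in blast)
  qed
  moreover obtain n where "(1/2) ^ n < Im \<tau>" using real_arch_pow_inv[OF assms(2), of "1/2"] by auto
  hence "1 / 2 ^ Suc n \<le> Im \<tau>" using assms(2) by (simp add: power_divide field_simps)
  ultimately show ?thesis using assms by blast
qed

section \<open>Transformation of the theta squares under the full modular group\<close>

text \<open>Euclidean descent on the lower row: with d = n c + e the matrix is M S T^n, where T is
  the unit translation, S is inversion and M has lower row (e, -c). Since |e| < |c|, induction
  applies to M. The factor \<open>k\<close> is left open because only the behaviour at cusps and
  nonvanishing depend on this lemma.\<close>

lemma theta_squares_SL2Z:
  fixes a b c d :: int
  assumes "a * d - b * c = 1" "U \<in> theta_squares"
  shows "\<exists>V\<in>theta_squares. \<exists>k. k \<noteq> 0 \<and> (\<forall>\<tau>. Im \<tau> > 0 \<longrightarrow>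
    U ((of_int a * \<tau> + of_int b) / (of_int c * \<tau> + of_int d)) = k * (of_int c * \<tau> + of_int d) * V \<tau>)"
  using assms
proof (induction "nat \<bar>c\<bar>" arbitrary: a b c d rule: less_induct)
  case less
  show ?case
  proof (cases "c = 0")
    case True
    hence "a = 1 \<and> d = 1 \<or> a = -1 \<and> d = -1" using less.prems by (simp add: zmult_eq_1_iff)
    \<comment> \<open>With \<open>a = d\<close> equal to 1 or -1, division by \<open>d\<close> is
      multiplication by \<open>d\<close>; the relation \<open>d * d = 1\<close> later puts the
      factor \<open>d\<close> into the automorphy factor.\<close>
    hence eq: "(of_int a * \<tau> + of_int b) / (of_int c * \<tau> + of_int d) = \<tau> + of_int (b * d)" 
      and d: "of_int d * of_int d = (1::complex)" for \<tau> :: complex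
      using True by (auto simp: field_simps)
    obtain V k where V: "V \<in> theta_squares" "k \<noteq> 0" "\<And>z. U (z + of_int (b * d)) = k * V z"
      using theta_squares_shift[OF less.prems(2)] by blast
    have "U ((of_int a * \<tau> + of_int b) / (of_int c * \<tau> + of_int d)) =
       (k * of_int d) * (of_int c * \<tau> + of_int d) * V \<tau>" for \<tau>
      unfolding eq V using True d by (simp add: mult_ac)
    moreover have "k * of_int d \<noteq> 0" using V d by auto
    ultimately show ?thesis using V(1) by blast
  next
    case False
    define n where "n = d div c"
    define e where "e = d mod c"
    have d: "d = n * c + e" by (simp add: n_def e_def)
    have "\<bar>e\<bar> < \<bar>c\<bar>" unfolding e_def using False abs_mod_less[of c d] by simp
    hence "nat \<bar>e\<bar> < nat \<bar>c\<bar>" by simp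
    moreover have "(b - a * n) * (- c) - (- a) * e = 1"
      using less.prems(1) by (simp add: d algebra_simps)
    ultimately obtain V k where V: "V \<in> theta_squares" "k \<noteq> 0" and Veq: "\<And>\<tau>. Im \<tau> > 0 \<Longrightarrow>
      U ((of_int (b - a * n) * \<tau> + of_int (- a)) / (of_int e * \<tau> + of_int (- c))) = k * (of_int e * \<tau> + of_int (- c)) * V \<tau>"
      using less.hyps[of e "b - a * n" "- c" "- a"] less.prems(2) by blast
    obtain X where X: "X \<in> theta_squares" "\<And>z. Im z > 0 \<Longrightarrow> V (- 1 / z) = - \<i> * z * X z"
      using theta_squares_inversion[OF V(1)] by blast
    obtain Y j where Y: "Y \<in> theta_squares" "j \<noteq> 0" "\<And>z. X (z + of_int n) = j * Y z"
      using theta_squares_shift[OF X(1)] by blast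
    have "U ((of_int a * \<tau> + of_int b) / (of_int c * \<tau> + of_int d)) =
       (k * \<i> * j) * (of_int c * \<tau> + of_int d) * Y \<tau>" if \<tau>: "Im \<tau> > 0" for \<tau>
    proof -
      define \<sigma> where "\<sigma> = \<tau> + of_int n"
      have "Im \<sigma> > 0" using \<tau> by (simp add: \<sigma>_def)
      moreover from this have "\<sigma> \<noteq> 0" by auto
      ultimately have \<sigma>: "Im \<sigma> > 0" "\<sigma> \<noteq> 0" by blast+
      have \<tau>_eq: "\<tau> = \<sigma> - of_int n" by (simp add: \<sigma>_def)
      have "(of_int a * \<tau> + of_int b) / (of_int c * \<tau> + of_int d) =
        (of_int a * \<sigma> + of_int (b - a * n)) / (of_int c * \<sigma> + of_int e)"
        by (simp add: \<tau>_eq d algebra_simps)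
      also have "\<dots> = ((of_int a * \<sigma> + of_int (b - a * n)) * (- 1 / \<sigma>)) / ((of_int c * \<sigma> + of_int e) * (- 1 / \<sigma>))"
        by (subst mult_divide_mult_cancel_right) (use \<sigma> in auto)
      also have "\<dots> = (of_int (b - a * n) * (- 1 / \<sigma>) + of_int (- a)) / (of_int e * (- 1 / \<sigma>) + of_int (- c))"
        using \<sigma> by (intro arg_cong2[of _ _ _ _ "(/)"]) (simp_all add: field_simps)
      finally have "U ((of_int a * \<tau> + of_int b) / (of_int c * \<tau> + of_int d)) =
        k * (of_int e * (- 1 / \<sigma>) + of_int (- c)) * (- \<i> * \<sigma> * X \<sigma>)"
        using Veq[OF neg_inverse_in_upper_half_plane[OF \<sigma>(1)]] X(2)[OF \<sigma>(1)] by (simp only:)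
      also have "X \<sigma> = j * Y \<tau>" by (simp add: \<sigma>_def Y)
      also have "k * (of_int e * (- 1 / \<sigma>) + of_int (- c)) * (- \<i> * \<sigma> * (j * Y \<tau>)) =
        (k * \<i> * j) * (of_int c * \<sigma> + of_int e) * Y \<tau>"
        using \<sigma> by (simp add: field_simps)
      also have "of_int c * \<sigma> + of_int e = of_int c * \<tau> + of_int d" by (simp add: \<sigma>_def d algebra_simps)
      finally show ?thesis .
    qed
    moreover have "k * \<i> * j \<noteq> 0" using V Y by simp
    ultimately show ?thesis using Y(1) by blast
  qed
qed

section \<open>The exact multiplier on Gamma_0(2)\<close>

text \<open>This is the form G of the overview: \<open>nome (2 * \<tau>)\<close> is the square of
  \<open>nome \<tau>\<close>, that is e^(2 pi i tau). Doubling the argument also lowers the period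
  from 2 to 1.\<close>

definition theta4_double_sq :: "complex \<Rightarrow> complex" where "theta4_double_sq \<tau> = (theta4_const (2 * \<tau>))\<^sup>2"

text \<open>
  The multiplier of \<open>\<theta>\<^sub>4(2\<tau>)\<^sup>2\<close> on \<open>\<Gamma>\<^sub>0(2)\<close>: it equals \<open>\<i>\<^bsup>d-1-c/2\<^esup>\<close> if \<open>4\<close> divides \<open>c\<close> and \<open>\<i>\<^bsup>-c/2\<^esup>\<close> otherwise.
\<close>

definition theta4_multiplier :: "int \<Rightarrow> int \<Rightarrow> complex" where
  "theta4_multiplier c d = (if c mod 4 = 0 then if even ((d - 1) div 2 + c div 4) then 1 else -1
              else if even (c div 4) then - \<i> else \<i>)"

lemma theta4_double_sq_shift: "theta4_double_sq (\<tau> + of_int n) = theta4_double_sq \<tau>"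
  using nome_shift[of "2 * \<tau>" "2 * n"] by (simp add: theta4_double_sq_def theta4_const_def distrib_left)

text \<open>The map \<open>\<tau> \<mapsto> \<tau>/(2\<tau> + 1)\<close> is conjugate to \<open>\<sigma> \<mapsto> \<sigma> - 1\<close> under \<open>\<sigma> = -1/(2\<tau>)\<close>.\<close>

lemma theta4_double_sq_V:
  assumes "Im \<tau> > 0"
  shows "theta4_double_sq (\<tau> / (2 * \<tau> + 1)) = - \<i> * (2 * \<tau> + 1) * theta4_double_sq \<tau>"
proof -
  define \<sigma> where "\<sigma> = - 1 / (2 * \<tau>)"
  have \<tau>: "\<tau> \<noteq> 0" using assms by auto
  have nz: "2 * \<tau> + 1 \<noteq> 0" using assms by (auto simp: complex_eq_iff)
  have \<sigma>: "Im \<sigma> > 0" unfolding \<sigma>_def using assms by (intro neg_inverse_in_upper_half_plane) simp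
  hence \<sigma>0: "\<sigma> \<noteq> 0" by auto
  have "- 1 / \<sigma> = 2 * \<tau>" using \<tau> by (simp add: \<sigma>_def)
  hence 1: "theta4_double_sq \<tau> = - \<i> * \<sigma> * (theta2_const \<sigma>)\<^sup>2"
    using theta4_const_inversion_square[OF \<sigma>] by (simp add: theta4_double_sq_def)
  have \<sigma>1: "\<sigma> - 1 = - (2 * \<tau> + 1) / (2 * \<tau>)" using \<tau> by (simp add: \<sigma>_def field_simps)
  have "2 * (\<tau> / (2 * \<tau> + 1)) = - 1 / (\<sigma> - 1)" unfolding \<sigma>1
  proof -
    show "2 * (\<tau> / N) = - 1 / (- N / (2 * \<tau>))" for N using \<tau> by simp
  qed
  hence 2: "theta4_double_sq (\<tau> / (2 * \<tau> + 1)) = - \<i> * (\<sigma> - 1) * (theta2_const (\<sigma> - 1))\<^sup>2"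
    using theta4_const_inversion_square[of "\<sigma> - 1"] \<sigma> by (simp add: theta4_double_sq_def)
  have "(nome (1/4))\<^sup>2 = \<i>"
  proof -
    have "nome (1/4) ^ 2 = nome (1/2)" using nome_mult_of_nat[of 2 "1/4"] by simp
    also have "\<dots> = cis (pi / 2)" by (simp add: nome_def cis_conv_exp mult_ac)
    finally show ?thesis by simp
  qed
  \<comment> \<open>The unit shift changes only the sign of the nome, which the even series
    \<open>theta2_nome\<close> ignores. What remains is the eighth root of unity from the prefactor;
    its square \<open>\<i>\<close> is the source of the multiplier.\<close>
  moreover have "theta2_const \<sigma> = nome (1/4) * theta2_const (\<sigma> - 1)"
    using nome_add[of "(\<sigma> - 1) / 4" "1/4"] nome_shift[of "\<sigma> - 1" 1] by (simp add: theta2_const_def diff_divide_distrib)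
  ultimately have "(theta2_const \<sigma>)\<^sup>2 = \<i> * (theta2_const (\<sigma> - 1))\<^sup>2" by (simp add: power_mult_distrib)
  moreover have "(2 * \<tau> + 1) * \<sigma> = \<sigma> - 1" using \<tau> by (simp add: \<sigma>_def field_simps)
  moreover have "- \<i> * (2 * \<tau> + 1) * (- \<i> * \<sigma> * (\<i> * X)) = - \<i> * ((2 * \<tau> + 1) * \<sigma>) * X" for X
    by (simp add: algebra_simps)
  ultimately show ?thesis unfolding 1 2 by (simp only:)
qed

lemma theta4_double_sq_V_inverse:
  assumes "Im \<tau> > 0"
  shows "theta4_double_sq (\<tau> / (- 2 * \<tau> + 1)) = \<i> * (- 2 * \<tau> + 1) * theta4_double_sq \<tau>"
proof -
  have nz: "- 2 * \<tau> + 1 \<noteq> 0" using assms by (auto simp: complex_eq_iff)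
  define \<sigma> where "\<sigma> = \<tau> / (- 2 * \<tau> + 1)"
  have "Im \<sigma> > 0" using moebius_upper_half_plane_int(2)[of 1 1 0 "-2" \<tau>] assms by (simp add: \<sigma>_def)
  moreover have eq: "2 * \<sigma> + 1 = 1 / (- 2 * \<tau> + 1)" using nz by (simp add: \<sigma>_def field_simps)
  moreover have "\<sigma> / (2 * \<sigma> + 1) = \<tau>" unfolding eq using nz by (simp add: \<sigma>_def)
  ultimately have "theta4_double_sq \<tau> = - \<i> * (1 / (- 2 * \<tau> + 1)) * theta4_double_sq \<sigma>" using theta4_double_sq_V[of \<sigma>] by simp
  hence "\<i> * (- 2 * \<tau> + 1) * theta4_double_sq \<tau> = (- 2 * \<tau> + 1) / (- 2 * \<tau> + 1) * theta4_double_sq \<sigma>" by simp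
  thus ?thesis using nz unfolding \<sigma>_def[symmetric] by simp
qed

lemma even_cases_mod4:
  fixes c :: int
  assumes "even c"
  shows "(\<exists>k. c = 4 * k) \<or> (\<exists>k. c = 4 * k + 2)"
  using assms by presburger

text \<open>Right multiplication by a unit translation changes the lower row (c, d) to (c, d + c) or
  (c, d - c); invariance mirrors the period 1 of \<open>theta4_double_sq\<close>.\<close>

lemma theta4_multiplier_T:
  assumes "even c" "odd d"
  shows "theta4_multiplier c (d + c) = theta4_multiplier c d" "theta4_multiplier c (d - c) = theta4_multiplier c d"
proof -
  obtain m where d: "d = 2 * m + 1" using assms by (elim oddE)
  have "even c' \<Longrightarrow> theta4_multiplier c' (2 * m + 1 + c') = theta4_multiplier c' (2 * m + 1)" for c' m
    by (drule even_cases_mod4) (auto simp: theta4_multiplier_def)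
  note * = this
  show "theta4_multiplier c (d + c) = theta4_multiplier c d" using *[of c m] assms by (simp add: d)
  obtain e where c: "c = 2 * e" using assms by (elim evenE)
  have "2 * (m - e) + 1 = d - c" by (simp add: c d)
  with *[OF assms(1), of "m - e"] show "theta4_multiplier c (d - c) = theta4_multiplier c d" by simp
qed

text \<open>The lower row becomes (c + 2d, d) on right multiplication by the matrix with rows (1, 0)
  and (2, 1), and \<open>- \<i>\<close> is the constant in
  \<open>theta4_double_sq_V\<close>.\<close>

lemma theta4_multiplier_V:
  assumes "even c" "odd d"
  shows "theta4_multiplier (c + 2 * d) d = - \<i> * theta4_multiplier c d"
proof -
  obtain m where d: "d = 2 * m + 1" using assms by (elim oddE)
  from even_cases_mod4[OF assms(1)] show ?thesis
  proof (elim disjE exE)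
    fix k assume c: "c = 4 * k"
    have "c + 2 * d = 4 * (k + m) + 2" by (simp add: c d)
    thus ?thesis by (simp add: c theta4_multiplier_def d del: distrib_left_numeral)
  next
    fix k assume c: "c = 4 * k + 2"
    have "c + 2 * d = 4 * (k + m + 1)" by (simp add: c d)
    thus ?thesis by (simp add: c theta4_multiplier_def d del: distrib_left_numeral)
  qed
qed

text \<open>A Euclidean algorithm with steps d -> d - s c and c -> c - 2 s d, realised by the two
  generators and their inverses. As \<open>c\<close> is even and \<open>d\<close> odd, their
  absolute values differ, so one of the steps always shortens the row until
  \<open>c = 0\<close>.\<close>

lemma theta4_double_sq_Gamma0_2:
  fixes a b c d :: int
  assumes "a * d - b * c = 1" "even c" "Im \<tau> > 0"
  shows "theta4_double_sq ((of_int a * \<tau> + of_int b) / (of_int c * \<tau> + of_int d)) = theta4_multiplier c d * (of_int c * \<tau> + of_int d) * theta4_double_sq \<tau>"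
  using assms
proof (induction "nat (\<bar>c\<bar> + \<bar>d\<bar>)" arbitrary: a b c d \<tau> rule: less_induct)
  case less
  have "odd (a * d)" using less.prems(1,2) by (simp add: diff_eq_eq)
  hence d: "odd d" by simp
  show ?case
  proof (cases "c = 0")
    case True
    hence "a = 1 \<and> d = 1 \<or> a = -1 \<and> d = -1" using less.prems by (simp add: zmult_eq_1_iff)
    thus ?thesis using True theta4_double_sq_shift[of \<tau> b] theta4_double_sq_shift[of \<tau> "- b"] by (auto simp: theta4_multiplier_def)
  next
    case False
    have neq: "\<bar>c\<bar> \<noteq> \<bar>d\<bar>" using d less.prems(2) by (metis dvd_abs_iff)
    have "d \<noteq> 0" using d by auto
    show ?thesis
    proof (cases "\<bar>d\<bar> > \<bar>c\<bar>")
      case True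
      \<comment> \<open>With this sign, \<open>s * c\<close> has the sign of \<open>d\<close>, so
        the subtraction reduces the absolute value.\<close>
      define s where "s = sgn c * sgn d"
      have s: "s = 1 \<or> s = -1" using False \<open>d \<noteq> 0\<close> by (auto simp: s_def sgn_if)
      have "\<bar>d - s * c\<bar> < \<bar>d\<bar>" using True False by (auto simp: s_def sgn_if split: if_splits)
      hence "nat (\<bar>c\<bar> + \<bar>d - s * c\<bar>) < nat (\<bar>c\<bar> + \<bar>d\<bar>)" by simp
      moreover have "a * (d - s * c) - (b - s * a) * c = 1" using less.prems(1) by (simp add: algebra_simps)
      moreover have "Im (\<tau> + of_int s) > 0" using less.prems by simp
      ultimately have IH: "theta4_double_sq ((of_int a * (\<tau> + of_int s) + of_int (b - s * a)) / (of_int c * (\<tau> + of_int s) + of_int (d - s * c))) =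
        theta4_multiplier c (d - s * c) * (of_int c * (\<tau> + of_int s) + of_int (d - s * c)) * theta4_double_sq (\<tau> + of_int s)"
        using less.prems(2) by (intro less.hyps) auto
      have "theta4_multiplier c (d - s * c) = theta4_multiplier c d" using s theta4_multiplier_T[OF less.prems(2) d] by auto
      with IH show ?thesis by (simp add: theta4_double_sq_shift algebra_simps)
    next
      case dc: False
      define s where "s = sgn c * sgn d"
      have s: "s = 1 \<or> s = -1" using False \<open>d \<noteq> 0\<close> by (auto simp: s_def sgn_if)
      define \<sigma> where "\<sigma> = \<tau> / (2 * of_int s * \<tau> + 1)"
      have nz: "2 * of_int s * \<tau> + 1 \<noteq> 0" using less.prems s by (auto simp: complex_eq_iff)
      have \<sigma>: "Im \<sigma> > 0" using moebius_upper_half_plane_int(2)[of 1 1 0 "2 * s" \<tau>] less.prems by (simp add: \<sigma>_def)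
      have "\<bar>c - 2 * s * d\<bar> < \<bar>c\<bar>" using dc neq False \<open>d \<noteq> 0\<close> by (auto simp: s_def sgn_if split: if_splits)
      hence "nat (\<bar>c - 2 * s * d\<bar> + \<bar>d\<bar>) < nat (\<bar>c\<bar> + \<bar>d\<bar>)" by simp
      moreover have "(a - 2 * s * b) * d - b * (c - 2 * s * d) = 1" using less.prems(1) by (simp add: algebra_simps)
      ultimately have IH: "theta4_double_sq ((of_int (a - 2 * s * b) * \<sigma> + of_int b) / (of_int (c - 2 * s * d) * \<sigma> + of_int d)) =
        theta4_multiplier (c - 2 * s * d) d * (of_int (c - 2 * s * d) * \<sigma> + of_int d) * theta4_double_sq \<sigma>"
        using less.prems(2) \<sigma> by (intro less.hyps) auto
      have num: "of_int (a - 2 * s * b) * \<sigma> + of_int b = (of_int a * \<tau> + of_int b) / (2 * of_int s * \<tau> + 1)"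
        and den: "of_int (c - 2 * s * d) * \<sigma> + of_int d = (of_int c * \<tau> + of_int d) / (2 * of_int s * \<tau> + 1)"
        using nz by (simp_all add: \<sigma>_def field_simps)
      \<comment> \<open>The factor \<open>- \<i> * of_int s\<close> covers both directions:
        \<open>- \<i>\<close> for the generator and \<open>\<i>\<close> for its inverse.\<close>
      have G: "theta4_double_sq \<sigma> = - \<i> * of_int s * (2 * of_int s * \<tau> + 1) * theta4_double_sq \<tau>"
        using s theta4_double_sq_V[OF less.prems(3)] theta4_double_sq_V_inverse[OF less.prems(3)] by (auto simp: \<sigma>_def)
      have theta4_multiplier: "theta4_multiplier (c - 2 * s * d) d * (- \<i> * of_int s) = theta4_multiplier c d"
        using s
      proof
        assume "s = 1"
        thus ?thesis using theta4_multiplier_V[of "c - 2 * d" d] less.prems(2) d by simp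
      next
        assume "s = -1"
        thus ?thesis using theta4_multiplier_V[of c d] less.prems(2) d by (simp add: mult_ac)
      qed
      have "theta4_double_sq ((of_int a * \<tau> + of_int b) / (of_int c * \<tau> + of_int d)) =
         theta4_multiplier (c - 2 * s * d) d * ((of_int c * \<tau> + of_int d) / (2 * of_int s * \<tau> + 1)) * (- \<i> * of_int s * (2 * of_int s * \<tau> + 1) * theta4_double_sq \<tau>)"
        using IH nz unfolding num den G by simp
      also have "\<dots> = (theta4_multiplier (c - 2 * s * d) d * (- \<i> * of_int s)) * (of_int c * \<tau> + of_int d) * theta4_double_sq \<tau>"
        using nz by (simp add: field_simps)
      finally show ?thesis unfolding theta4_multiplier .
    qed
  qed
qed

section \<open>The Wronskian quotient\<close>

text \<open>Equal to (U V' - U' V) / (U V)^2 up to the constant. Differentiating the quotient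
  \<open>V z / U z\<close> lets a common automorphy factor cancel beforehand, so no derivative of c
  z + d ever appears.\<close>

definition wronskian_quotient :: "(complex \<Rightarrow> complex) \<Rightarrow> (complex \<Rightarrow> complex) \<Rightarrow> complex \<Rightarrow> complex" where
  "wronskian_quotient U V \<tau> = deriv (\<lambda>z. V z / U z) \<tau> / (V \<tau>)\<^sup>2 / (4 * of_real pi * \<i>)"

lemma wronskian_quotient_swap:
  assumes "U field_differentiable at \<tau>" "V field_differentiable at \<tau>" "U \<tau> \<noteq> 0" "V \<tau> \<noteq> 0"
  shows "wronskian_quotient V U \<tau> = - wronskian_quotient U V \<tau>"
  using assms by (simp add: wronskian_quotient_def deriv_divide field_simps power2_eq_square)

text \<open>In \<open>R / P\<close> the automorphy factors cancel. The chain rule contributes the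
  determinant over (c tau + d)^2, and this square is cancelled by the one in \<open>R\<close>
  squared: weight 0 results. For the constants, \<open>j / k\<close> from the quotient over j^2
  leaves 1 / (k j).\<close>

lemma wronskian_quotient_moebius:
  fixes a b c d :: real
  assumes det: "a * d - b * c > 0"
    and P: "P holomorphic_on upper_half_plane" "\<And>\<tau>. Im \<tau> > 0 \<Longrightarrow> P \<tau> \<noteq> 0"
    and R: "R holomorphic_on upper_half_plane" "\<And>\<tau>. Im \<tau> > 0 \<Longrightarrow> R \<tau> \<noteq> 0"
    and PU: "\<And>\<tau>. Im \<tau> > 0 \<Longrightarrow> P ((of_real a * \<tau> + of_real b) / (of_real c * \<tau> + of_real d)) = k * (of_real c * \<tau> + of_real d) * U \<tau>"
    and RV: "\<And>\<tau>. Im \<tau> > 0 \<Longrightarrow> R ((of_real a * \<tau> + of_real b) / (of_real c * \<tau> + of_real d)) = j * (of_real c * \<tau> + of_real d) * V \<tau>"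
    and \<tau>: "Im \<tau> > 0"
  shows "wronskian_quotient P R ((of_real a * \<tau> + of_real b) / (of_real c * \<tau> + of_real d)) =
    wronskian_quotient U V \<tau> / (of_real (a * d - b * c) * k * j)"
proof -
  define m where "m = (\<lambda>z::complex. (of_real a * z + of_real b) / (of_real c * z + of_real d))"
  define D where "D = of_real c * \<tau> + of_real d"
  note H = moebius_upper_half_plane[OF det]
  have D: "D \<noteq> 0" using H(1)[OF \<tau>] by (simp add: D_def)
  have nz: "k \<noteq> 0" "j \<noteq> 0" "\<And>z. Im z > 0 \<Longrightarrow> U z \<noteq> 0" "\<And>z. Im z > 0 \<Longrightarrow> V z \<noteq> 0"
    using PU P(2)[OF H(2)] RV R(2)[OF H(2)] \<tau> by (metis mult_zero_left mult_zero_right)+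
  have "(\<lambda>z. R z / P z) holomorphic_on upper_half_plane"
    using P R by (intro holomorphic_intros) (auto simp: upper_half_plane_def)
  hence "(\<lambda>z. R z / P z) field_differentiable at (m \<tau>)"
    using H(2)[OF \<tau>] open_upper_half_plane
    by (auto simp: holomorphic_on_open upper_half_plane_def field_differentiable_def m_def)
  hence 1: "((\<lambda>z. R z / P z) has_field_derivative deriv (\<lambda>z. R z / P z) (m \<tau>)) (at (m \<tau>))"
    by (simp add: field_differentiable_derivI)
  have 2: "(m has_field_derivative of_real (a * d - b * c) / D\<^sup>2) (at \<tau>)"
    unfolding m_def using D unfolding D_def
    by (auto intro!: derivative_eq_intros simp: power2_eq_square algebra_simps)
  have "((\<lambda>z. R (m z) / P (m z)) has_field_derivative
     deriv (\<lambda>z. R z / P z) (m \<tau>) * (of_real (a * d - b * c) / D\<^sup>2)) (at \<tau>)"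
    using DERIV_chain2[OF 1 2] .
  hence "((\<lambda>z. k / j * (R (m z) / P (m z))) has_field_derivative
     k / j * (deriv (\<lambda>z. R z / P z) (m \<tau>) * (of_real (a * d - b * c) / D\<^sup>2))) (at \<tau>)"
    by (rule DERIV_cmult)
  hence "((\<lambda>z. V z / U z) has_field_derivative
     k / j * (deriv (\<lambda>z. R z / P z) (m \<tau>) * (of_real (a * d - b * c) / D\<^sup>2))) (at \<tau>)"
  proof (rule has_field_derivative_transform_within_open[OF _ open_upper_half_plane])
    fix z assume "z \<in> upper_half_plane"
    hence z: "Im z > 0" by (simp add: upper_half_plane_def)
    show "k / j * (R (m z) / P (m z)) = V z / U z"
      unfolding m_def PU[OF z] RV[OF z] using nz H(1)[OF z] by simp
  qed (use \<tau> in \<open>auto simp: upper_half_plane_def\<close>)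
  hence "deriv (\<lambda>z. V z / U z) \<tau> = k / j * (deriv (\<lambda>z. R z / P z) (m \<tau>) * (of_real (a * d - b * c) / D\<^sup>2))"
    by (rule DERIV_imp_deriv)
  moreover have "R (m \<tau>) = j * D * V \<tau>" unfolding m_def D_def by (rule RV[OF \<tau>])
  moreover have "of_real (a * d - b * c) \<noteq> (0 :: complex)" using det by (simp only: of_real_eq_0_iff)
  ultimately show ?thesis
    unfolding m_def[symmetric, THEN fun_cong] wronskian_quotient_def using nz(1,2) D nz(4)[OF \<tau>]
    by (simp add: field_simps power2_eq_square del: of_real_diff of_real_mult)
qed

text \<open>In the local parameter w the derivative d/dtau is (2 pi i / h) w d/dw, so the quotient
  is built from \<open>F\<close>, \<open>G\<close> and a derivative in w. A zero of \<open>F\<close>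
  or \<open>G\<close> at 0 costs at most a pole.\<close>

lemma wronskian_quotient_meromorphic:
  fixes h :: nat
  assumes F: "F holomorphic_on ball 0 1" "G holomorphic_on ball 0 1" and h: "h > 0"
    and U: "\<And>\<tau>. Im \<tau> > 0 \<Longrightarrow> U \<tau> = F (exp (2 * of_real pi * \<i> * \<tau> / of_nat h))"
    and V: "\<And>\<tau>. Im \<tau> > 0 \<Longrightarrow> V \<tau> = G (exp (2 * of_real pi * \<i> * \<tau> / of_nat h))"
    and nz: "\<And>\<tau>. Im \<tau> > 0 \<Longrightarrow> U \<tau> \<noteq> 0"
  shows "\<exists>E. E meromorphic_on {0} \<and> (\<forall>\<tau>. Im \<tau> > 0 \<longrightarrow> wronskian_quotient U V \<tau> = E (exp (2 * of_real pi * \<i> * \<tau> / of_nat h)))"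
proof -
  let ?e = "\<lambda>\<tau>. exp (2 * of_real pi * \<i> * \<tau> / of_nat h)"
  define E where "E = (\<lambda>w. deriv (\<lambda>w. G w / F w) w * (w * (2 * of_real pi * \<i> / of_nat h)) / (G w)\<^sup>2 / (4 * of_real pi * \<i>))"
  have "F analytic_on ball 0 1" "G analytic_on ball 0 1"
    using F by (auto simp: analytic_on_open)
  hence "F analytic_on {0}" "G analytic_on {0}" by (auto elim: analytic_on_subset)
  hence "F meromorphic_on {0}" "G meromorphic_on {0}" by (auto intro: analytic_on_imp_meromorphic_on)
  hence "E meromorphic_on {0}" unfolding E_def
    by (intro meromorphic_intros)
  moreover have "wronskian_quotient U V \<tau> = E (?e \<tau>)" if \<tau>: "Im \<tau> > 0" for \<tau>
  proof -
    have e1: "norm (?e z) < 1" if "Im z > 0" for z using that h by simp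
    have "F (?e \<tau>) \<noteq> 0" using U[OF \<tau>] nz[OF \<tau>] by simp
    hence "(\<lambda>w. G w / F w) field_differentiable at (?e \<tau>)"
      using F e1[OF \<tau>] by (intro field_differentiable_divide holomorphic_on_imp_differentiable_at[of _ "ball 0 1"]) auto
    hence 1: "((\<lambda>w. G w / F w) has_field_derivative deriv (\<lambda>w. G w / F w) (?e \<tau>)) (at (?e \<tau>))"
      by (simp add: field_differentiable_derivI)
    have 2: "(?e has_field_derivative ?e \<tau> * (2 * of_real pi * \<i> / of_nat h)) (at \<tau>)"
      using h by (auto intro!: derivative_eq_intros)
    have "((\<lambda>z. V z / U z) has_field_derivative deriv (\<lambda>w. G w / F w) (?e \<tau>) * (?e \<tau> * (2 * of_real pi * \<i> / of_nat h))) (at \<tau>)"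
      by (rule has_field_derivative_transform_within_open[OF DERIV_chain2[OF 1 2] open_upper_half_plane])
         (use \<tau> U V in \<open>auto simp: upper_half_plane_def\<close>)
    hence "deriv (\<lambda>z. V z / U z) \<tau> = deriv (\<lambda>w. G w / F w) (?e \<tau>) * (?e \<tau> * (2 * of_real pi * \<i> / of_nat h))"
      by (rule DERIV_imp_deriv)
    thus ?thesis by (simp add: wronskian_quotient_def E_def V[OF \<tau>])
  qed
  ultimately show ?thesis by blast
qed

section \<open>Expansions at the cusps\<close>

text \<open>The square root of the nome serves all three squares: the prefactor of
  \<open>theta2_const\<close>, once squared, is exactly \<open>nome (\<tau> / 2)\<close>.\<close>

lemma theta_squares_nome_expansion:
  assumes "U \<in> theta_squares"
  shows "\<exists>F. F holomorphic_on ball 0 1 \<and> (\<forall>\<tau>. U \<tau> = F (nome (\<tau> / 2)))"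
proof -
  have n2: "nome \<tau> = nome (\<tau> / 2) ^ 2" and n4: "nome (\<tau> / 2) = nome (\<tau> / 4) ^ 2" for \<tau>
    using nome_mult_of_nat[of 2 "\<tau> / 2"] nome_mult_of_nat[of 2 "\<tau> / 4"] by simp_all
  have sq: "x\<^sup>2 \<in> ball 0 1" if "x \<in> ball 0 1" for x :: complex
    using that by (simp add: norm_power power_less_one_iff abs_square_less_1)
  have hol: "(\<lambda>x. (theta3_nome (x\<^sup>2))\<^sup>2) holomorphic_on ball 0 1"
    "(\<lambda>x. (theta3_nome (- x\<^sup>2))\<^sup>2) holomorphic_on ball 0 1"
    "(\<lambda>x. x * (theta2_nome (x\<^sup>2))\<^sup>2) holomorphic_on ball 0 1"
    using sq by (auto intro!: holomorphic_intros holomorphic_on_compose_gen[OF _ holomorphic_theta3_nome, unfolded o_def]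
        holomorphic_on_compose_gen[OF _ holomorphic_theta2_nome, unfolded o_def])
  from assms show ?thesis unfolding theta_squares_def
  proof (elim insertE emptyE)
    assume "U = (\<lambda>\<tau>. (theta2_const \<tau>)\<^sup>2)"
    thus ?thesis by (intro exI[of _ "\<lambda>x. x * (theta2_nome (x\<^sup>2))\<^sup>2"] conjI hol allI)
        (simp only: theta2_const_def n2[symmetric] power_mult_distrib n4[symmetric])
  next
    assume "U = (\<lambda>\<tau>. (theta3_const \<tau>)\<^sup>2)"
    thus ?thesis by (intro exI[of _ "\<lambda>x. (theta3_nome (x\<^sup>2))\<^sup>2"] conjI hol allI)
        (simp only: theta3_const_def n2[symmetric])
  next
    assume "U = (\<lambda>\<tau>. (theta4_const \<tau>)\<^sup>2)"
    thus ?thesis by (intro exI[of _ "\<lambda>x. (theta3_nome (- x\<^sup>2))\<^sup>2"] conjI hol allI)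
        (simp only: theta4_const_def n2[symmetric])
  qed
qed

text \<open>The shift \<open>r\<close> contributes a constant of modulus 1 and the scaling a power
  of the local parameter. The free factor \<open>K\<close> allows expansions with different
  denominators to share one width.\<close>

lemma theta_squares_affine_expansion:
  fixes p s K :: nat and r :: int
  assumes "U \<in> theta_squares" "p > 0" "s > 0" "K > 0"
  shows "\<exists>F. F holomorphic_on ball 0 1 \<and>
    (\<forall>\<tau>. U ((of_nat p * \<tau> + of_int r) / of_nat s) = F (exp (2 * of_real pi * \<i> * \<tau> / of_nat (4 * s * K))))"
proof -
  obtain F where F: "F holomorphic_on ball 0 1" "\<And>\<tau>. U \<tau> = F (nome (\<tau> / 2))"
    using theta_squares_nome_expansion[OF assms(1)] by blast
  define \<rho> where "\<rho> = nome (of_int r / of_nat (2 * s))"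
  have \<rho>: "norm \<rho> = 1" by (simp add: \<rho>_def norm_nome)
  have "(\<lambda>w. F (\<rho> * w ^ (p * K))) holomorphic_on ball 0 1"
  proof (rule holomorphic_on_compose_gen[OF _ F(1), unfolded o_def])
    show "(\<lambda>w. \<rho> * w ^ (p * K)) ` ball 0 1 \<subseteq> ball 0 1"
      using \<rho> assms by (auto simp: norm_mult norm_power power_less_one_iff)
  qed (intro holomorphic_intros)
  moreover have "U ((of_nat p * \<tau> + of_int r) / of_nat s) =
    F (\<rho> * exp (2 * of_real pi * \<i> * \<tau> / of_nat (4 * s * K)) ^ (p * K))" for \<tau>
  proof -
    have "nome ((of_nat p * \<tau> + of_int r) / of_nat s / 2) = \<rho> * nome (of_nat p * \<tau> / of_nat (2 * s))"
      using nome_add[of "of_int r / of_nat (2 * s)" "of_nat p * \<tau> / of_nat (2 * s)"] assms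
      by (simp add: \<rho>_def field_simps)
    also have "nome (of_nat p * \<tau> / of_nat (2 * s)) = exp (2 * of_real pi * \<i> * \<tau> / of_nat (4 * s * K)) ^ (p * K)"
      unfolding exp_of_nat_mult[symmetric] nome_def using assms by (intro arg_cong[of _ _ exp]) (simp add: field_simps)
    finally show ?thesis by (simp add: F(2))
  qed
  ultimately show ?thesis by blast
qed

text \<open>Hermite normal form: diag(N, 1) times the given matrix equals a matrix of SL_2(Z) times
  an upper triangular one with rows (p, r) and (0, s), p s = N. The first factor permutes the theta
  squares, the second is an affine change of argument.\<close>

lemma theta4_const_square_cusp:
  fixes a b c d :: int and N :: nat
  assumes det: "a * d - b * c = 1" and N: "N > 0"
  shows "\<exists>V\<in>theta_squares. \<exists>k p s r. k \<noteq> 0 \<and> p > 0 \<and> s > 0 \<and> (\<forall>\<tau>. Im \<tau> > 0 \<longrightarrow>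
    (theta4_const (of_nat N * ((of_int a * \<tau> + of_int b) / (of_int c * \<tau> + of_int d))))\<^sup>2 =
    k * (of_int c * \<tau> + of_int d) * V ((of_nat p * \<tau> + of_int r) / of_nat s))"
proof -
  define p where "p = gcd (int N * a) c"
  have "\<not> (int N * a = 0 \<and> c = 0)" using det N by auto
  hence p: "p > 0" by (auto simp: p_def)
  define a' where "a' = int N * a div p"
  define c' where "c' = c div p"
  have a': "int N * a = p * a'" and c': "c = p * c'" by (simp_all add: a'_def c'_def p_def)
  have "coprime a' c'" unfolding a'_def c'_def p_def
    by (rule div_gcd_coprime) (use \<open>\<not> _\<close> in auto)
  then obtain u v where uv: "u * a' + v * c' = 1" using bezout_int[of a' c'] by auto
  \<comment> \<open>The SL_2(Z) factor has rows (a', -v) and (c', u). Multiplying by its inverse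
    from the left gives the triangular matrix, from which \<open>r\<close> and \<open>s\<close> are
    read off.\<close>
  define r where "r = u * (int N * b) + v * d"
  define s where "s = a' * d - c' * (int N * b)"
  have "p * s = int N * (a * d - b * c)" unfolding s_def using a' c' by (simp add: algebra_simps)
  hence ps: "p * s = int N" using det by simp
  hence s: "s > 0" using p N by (metis of_nat_0_less_iff zero_less_mult_pos)
  have e1: "a' * r - v * s = int N * b"
  proof -
    have "a' * r - v * s = (u * a' + v * c') * (int N * b)" by (simp add: r_def s_def algebra_simps)
    thus ?thesis using uv by simp
  qed
  have e2: "c' * r + u * s = d"
  proof -
    have "c' * r + u * s = (u * a' + v * c') * d" by (simp add: r_def s_def algebra_simps)
    thus ?thesis using uv by simp
  qed
  have "a' * u - (- v) * c' = 1" using uv by (simp add: algebra_simps)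
  from theta_squares_SL2Z[OF this, of "\<lambda>\<tau>. (theta4_const \<tau>)\<^sup>2"]
  obtain V k where V: "V \<in> theta_squares" "k \<noteq> 0" "\<And>\<tau>. Im \<tau> > 0 \<Longrightarrow>
    (theta4_const ((of_int a' * \<tau> + of_int (- v)) / (of_int c' * \<tau> + of_int u)))\<^sup>2 = k * (of_int c' * \<tau> + of_int u) * V \<tau>"
    by (auto simp: theta_squares_def)
  have "(theta4_const (of_nat N * ((of_int a * \<tau> + of_int b) / (of_int c * \<tau> + of_int d))))\<^sup>2 =
    (k / of_int s) * (of_int c * \<tau> + of_int d) * V ((of_nat (nat p) * \<tau> + of_int r) / of_nat (nat s))" if \<tau>: "Im \<tau> > 0" for \<tau>
  proof -
    define \<sigma> where "\<sigma> = (of_int p * \<tau> + of_int r) / of_int s"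
    have s0: "of_int s \<noteq> (0::complex)" using s by simp
    have "Im \<sigma> > 0" using moebius_upper_half_plane_int(2)[of p s r 0 \<tau>] p s \<tau> by (simp add: \<sigma>_def)
    note V3 = V(3)[OF this]
    have den: "of_int c' * \<sigma> + of_int u = (of_int c * \<tau> + of_int d) / of_int s"
    proof -
      have "of_int c' * \<sigma> + of_int u = (of_int (p * c') * \<tau> + of_int (c' * r + u * s)) / of_int s"
        using s0 by (simp add: \<sigma>_def field_simps)
      thus ?thesis by (simp only: e2 c'[symmetric])
    qed
    have num: "of_int a' * \<sigma> + of_int (- v) = of_nat N * (of_int a * \<tau> + of_int b) / of_int s"
    proof -
      have "of_int a' * \<sigma> + of_int (- v) = (of_int (p * a') * \<tau> + of_int (a' * r - v * s)) / of_int s"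
        using s0 by (simp add: \<sigma>_def field_simps)
      thus ?thesis unfolding e1 a'[symmetric] by (simp add: algebra_simps)
    qed
    have eq: "of_nat N * ((of_int a * \<tau> + of_int b) / (of_int c * \<tau> + of_int d)) =
      (of_int a' * \<sigma> + of_int (- v)) / (of_int c' * \<sigma> + of_int u)"
      unfolding num den using s0 by simp
    have \<sigma>: "\<sigma> = (of_nat (nat p) * \<tau> + of_int r) / of_nat (nat s)" using p s by (simp add: \<sigma>_def)
    have "(theta4_const (of_nat N * ((of_int a * \<tau> + of_int b) / (of_int c * \<tau> + of_int d))))\<^sup>2 =
      k * (of_int c' * \<sigma> + of_int u) * V \<sigma>" unfolding eq by (rule V3)
    also have "\<dots> = (k / of_int s) * (of_int c * \<tau> + of_int d) * V \<sigma>" unfolding den by simp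
    finally show ?thesis unfolding \<sigma> .
  qed
  moreover have "k / of_int s \<noteq> 0" "nat p > 0" "nat s > 0" using V p s by auto
  ultimately show ?thesis using V(1) by blast
qed

section \<open>Identification of \<open>Dhat\<close> with the Wronskian quotient\<close>

lemma holomorphic_theta4: "theta4 holomorphic_on ball 0 1"
proof -
  have "(\<lambda>q. theta3_nome (- q)) holomorphic_on ball 0 1"
    by (rule holomorphic_on_compose_gen[OF _ holomorphic_theta3_nome, unfolded o_def])
       (auto intro!: holomorphic_intros)
  thus ?thesis by (rule holomorphic_transform) (simp add: theta4_conv_theta3_nome)
qed

lemma theta4_double_sq_conv_theta4: "Im \<tau> > 0 \<Longrightarrow> theta4_double_sq \<tau> = (theta4 (nome (2 * \<tau>)))\<^sup>2"
  by (simp add: theta4_double_sq_def theta4_const_def theta4_conv_theta3_nome norm_nome_less_1)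

lemma theta4_double_sq_nonzero: "Im \<tau> > 0 \<Longrightarrow> theta4_double_sq \<tau> \<noteq> 0"
  using theta_squares_nonzero[of "\<lambda>\<tau>. (theta4_const \<tau>)\<^sup>2" "2 * \<tau>"] by (simp add: theta4_double_sq_def theta_squares_def)

lemma holomorphic_theta4_double_sq_mult:
  assumes "n > 0"
  shows "(\<lambda>\<tau>. theta4_double_sq (of_nat n * \<tau>)) holomorphic_on upper_half_plane"
  unfolding theta4_double_sq_def
  by (intro holomorphic_intros holomorphic_on_compose_gen[OF _ holomorphic_theta4_const, unfolded o_def])
     (use assms in \<open>auto simp: upper_half_plane_def intro!: holomorphic_intros\<close>)

lemma holomorphic_theta4_double_sq: "theta4_double_sq holomorphic_on upper_half_plane"
  using holomorphic_theta4_double_sq_mult[of 1] by simp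

lemma theta4_double_sq_mult_has_field_derivative:
  assumes n: "n > 0" and \<tau>: "Im \<tau> > 0"
  defines "Q \<equiv> nome (2 * \<tau>)"
  shows "((\<lambda>\<tau>. theta4_double_sq (of_nat n * \<tau>)) has_field_derivative
    4 * of_real pi * \<i> * of_nat n * theta4 (Q ^ n) * deriv theta4 (Q ^ n) * Q ^ n) (at \<tau>)"
proof -
  have eq: "nome (2 * (of_nat n * z)) = nome (2 * z) ^ n" for z
    using nome_mult_of_nat[of n "2 * z"] by (simp add: mult_ac)
  have Q: "norm (Q ^ n) < 1" using norm_nome_less_1[of "2 * \<tau>"] \<tau> n by (simp add: Q_def norm_power power_less_one_iff)
  hence 1: "(theta4 has_field_derivative deriv theta4 (Q ^ n)) (at (Q ^ n))"
    by (intro holomorphic_derivI[OF holomorphic_theta4]) auto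
  have 2: "((\<lambda>z. nome (2 * (of_nat n * z))) has_field_derivative Q ^ n * (2 * of_real pi * \<i> * of_nat n)) (at \<tau>)"
    unfolding Q_def eq[symmetric] unfolding nome_def by (auto intro!: derivative_eq_intros)
  have "((\<lambda>z. theta4 (nome (2 * (of_nat n * z)))) has_field_derivative
     deriv theta4 (Q ^ n) * (Q ^ n * (2 * of_real pi * \<i> * of_nat n))) (at \<tau>)"
    by (rule DERIV_chain2[OF _ 2]) (use 1 in \<open>simp add: eq Q_def\<close>)
  hence "((\<lambda>z. (theta4 (nome (2 * (of_nat n * z))))\<^sup>2) has_field_derivative
     4 * of_real pi * \<i> * of_nat n * theta4 (Q ^ n) * deriv theta4 (Q ^ n) * Q ^ n) (at \<tau>)"
    by (auto intro!: derivative_eq_intros simp: eq Q_def)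
  thus ?thesis
    by (rule has_field_derivative_transform_within_open[OF _ open_upper_half_plane])
       (use \<tau> n in \<open>auto simp: upper_half_plane_def theta4_double_sq_conv_theta4\<close>)
qed

text \<open>Here d/dtau is 2 pi i times q d/dq in the variable q = e^(2 pi i tau), and squaring
  \<open>theta4\<close> doubles its logarithmic derivative; this is the origin of 4 pi i.
  Zero-freeness justifies cancelling the theta factors.\<close>

lemma Dhat_conv_wronskian_quotient:
  assumes l: "l > 0" and \<tau>: "Im \<tau> > 0"
  shows "Dhat l ((exp (of_real pi * \<i> * \<tau>))\<^sup>2) = wronskian_quotient theta4_double_sq (\<lambda>z. theta4_double_sq (of_nat l * z)) \<tau>"
proof -
  define Q where "Q = nome (2 * \<tau>)"
  have Q: "(exp (of_real pi * \<i> * \<tau>))\<^sup>2 = Q" using nome_mult_of_nat[of 2 \<tau>] by (simp add: Q_def nome_def)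
  have Q1: "norm Q < 1" using norm_nome_less_1[of "2 * \<tau>"] \<tau> by (simp add: Q_def)
  hence Ql: "norm (Q ^ l) < 1" using l by (simp add: norm_power power_less_one_iff)
  have Gl: "theta4_double_sq (of_nat l * \<tau>) = (theta4 (Q ^ l))\<^sup>2"
    using theta4_double_sq_conv_theta4[of "of_nat l * \<tau>"] nome_mult_of_nat[of l "2 * \<tau>"] l \<tau> by (simp add: Q_def mult_ac)
  have G: "theta4_double_sq \<tau> = (theta4 Q)\<^sup>2" using theta4_double_sq_conv_theta4[OF \<tau>] by (simp add: Q_def)
  have nz: "theta4 Q \<noteq> 0" "theta4 (Q ^ l) \<noteq> 0"
    using theta4_double_sq_nonzero[OF \<tau>] theta4_double_sq_nonzero[of "of_nat l * \<tau>"] l \<tau> G Gl by auto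
  have "(theta4 has_field_derivative deriv theta4 (Q ^ l)) (at (Q ^ l))"
    using Ql by (intro holomorphic_derivI[OF holomorphic_theta4]) auto
  hence "((\<lambda>x. theta4 (x ^ l)) has_field_derivative deriv theta4 (Q ^ l) * (of_nat l * Q ^ (l - 1))) (at Q)"
    by (rule DERIV_chain2) (auto intro!: derivative_eq_intros)
  hence d: "deriv (\<lambda>x. theta4 (x ^ l)) Q = deriv theta4 (Q ^ l) * (of_nat l * Q ^ (l - 1))"
    by (rule DERIV_imp_deriv)
  have Ql': "Q * Q ^ (l - 1) = Q ^ l" using l by (simp add: power_eq_if)
  have d1: "(theta4_double_sq has_field_derivative 4 * of_real pi * \<i> * theta4 Q * deriv theta4 Q * Q) (at \<tau>)"
    using theta4_double_sq_mult_has_field_derivative[of 1 \<tau>] \<tau> by (simp add: Q_def)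
  have d2: "((\<lambda>z. theta4_double_sq (of_nat l * z)) has_field_derivative
     4 * of_real pi * \<i> * of_nat l * theta4 (Q ^ l) * deriv theta4 (Q ^ l) * Q ^ l) (at \<tau>)"
    using theta4_double_sq_mult_has_field_derivative[OF l \<tau>] by (simp add: Q_def)
  have d3: "deriv (\<lambda>z. theta4_double_sq (of_nat l * z) / theta4_double_sq z) \<tau> =
     (4 * of_real pi * \<i> * of_nat l * theta4 (Q ^ l) * deriv theta4 (Q ^ l) * Q ^ l * (theta4 Q)\<^sup>2 -
      (theta4 (Q ^ l))\<^sup>2 * (4 * of_real pi * \<i> * theta4 Q * deriv theta4 Q * Q)) / ((theta4 Q)\<^sup>2 * (theta4 Q)\<^sup>2)"
    using DERIV_imp_deriv[OF DERIV_divide[OF d2 d1]] theta4_double_sq_nonzero[OF \<tau>] unfolding G Gl by simp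
  have d4: "Dhat l Q = 1 / (theta4 Q ^ 3 * theta4 (Q ^ l) ^ 3) *
    (theta4 Q * (deriv theta4 (Q ^ l) * of_nat l * Q ^ l) - theta4 (Q ^ l) * (Q * deriv theta4 Q))"
    unfolding Dhat_def det_mat2 d Ql'[symmetric] by (simp add: mult_ac)
  show ?thesis
    unfolding Q wronskian_quotient_def Gl d3 d4 using nz by (simp add: field_simps power2_eq_square power3_eq_cube)
qed

section \<open>Invariance and cusps\<close>

text \<open>If 4 divides \<open>e\<close>, both multipliers are the same sign. If \<open>e\<close>
  is 2 mod 4, both are \<open>\<i>\<close> or \<open>- \<i>\<close>, and they are opposite exactly
  when (l - 1) / 2 is odd. So the product is -1 only for l = 1 mod 4 and \<open>e\<close> = 2 mod
  4.\<close>

lemma theta4_multiplier_mult_left: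
  fixes e d l :: int
  assumes "even e" "odd l"
  shows "(theta4_multiplier (l * e) d * theta4_multiplier e d)\<^sup>2 = 1"
    and "l mod 4 = 3 \<Longrightarrow> theta4_multiplier (l * e) d * theta4_multiplier e d = 1"
proof -
  obtain j where l: "l = 2 * j + 1" using assms by (elim oddE)
  have "(theta4_multiplier (l * e) d * theta4_multiplier e d)\<^sup>2 = 1 \<and> (l mod 4 = 3 \<longrightarrow> theta4_multiplier (l * e) d * theta4_multiplier e d = 1)"
    using even_cases_mod4[OF assms(1)]
  proof (elim disjE exE)
    fix k assume e: "e = 4 * k"
    have "l * e = 4 * (l * k)" by (simp add: e)
    moreover have "even (x + l * k) \<longleftrightarrow> even (x + k)" for x using assms(2) by simp
    ultimately show ?thesis by (simp add: theta4_multiplier_def e)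
  next
    fix k assume e: "e = 4 * k + 2"
    have le: "l * e = 4 * (l * k + j) + 2" by (simp add: e l algebra_simps)
    have "even (l * k + j) \<longleftrightarrow> even (k + j)" using assms(2) by simp
    moreover have "l mod 4 = 3 \<longleftrightarrow> odd j" unfolding l by presburger
    ultimately show ?thesis unfolding le using assms(2) by (simp add: theta4_multiplier_def e power2_eq_square del: distrib_left_numeral)
  qed
  thus "(theta4_multiplier (l * e) d * theta4_multiplier e d)\<^sup>2 = 1" "l mod 4 = 3 \<Longrightarrow> theta4_multiplier (l * e) d * theta4_multiplier e d = 1" by blast+
qed

text \<open>For \<open>c\<close> = 2 mod 4 the multiplier does not depend on the second argument, so
  the product is the square of \<open>\<i>\<close> or \<open>- \<i>\<close>. For \<open>c\<close>
  divisible by 4 the two signs differ by (-1)^((l - 1) / 2), since \<open>d\<close> is odd.\<close>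

lemma theta4_multiplier_mult_right:
  fixes c d l :: int
  assumes "even c" "odd l" "odd d"
  shows "(theta4_multiplier c (d * l) * theta4_multiplier c d)\<^sup>2 = 1"
    and "l mod 4 = 3 \<Longrightarrow> theta4_multiplier c (d * l) * theta4_multiplier c d = - 1"
proof -
  obtain j where l: "l = 2 * j + 1" using assms by (elim oddE)
  obtain m where d: "d = 2 * m + 1" using assms by (elim oddE)
  have dl: "d * l = 2 * (2 * m * j + m + j) + 1" by (simp add: d l algebra_simps)
  have "l mod 4 = 3 \<longleftrightarrow> odd j" unfolding l by presburger
  hence "(theta4_multiplier c (d * l) * theta4_multiplier c d)\<^sup>2 = 1 \<and> (l mod 4 = 3 \<longrightarrow> theta4_multiplier c (d * l) * theta4_multiplier c d = - 1)"
    using even_cases_mod4[OF assms(1)] unfolding dl unfolding d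
    by (elim disjE exE) (simp_all add: theta4_multiplier_def power2_eq_square del: distrib_left_numeral)
  thus "(theta4_multiplier c (d * l) * theta4_multiplier c d)\<^sup>2 = 1" "l mod 4 = 3 \<Longrightarrow> theta4_multiplier c (d * l) * theta4_multiplier c d = - 1" by blast+
qed

lemma theta4_double_sq_mult_nonzero: "n > 0 \<Longrightarrow> Im \<tau> > 0 \<Longrightarrow> theta4_double_sq (of_nat n * \<tau>) \<noteq> 0"
  by (rule theta4_double_sq_nonzero) simp

text \<open>Multiplication by l conjugates the matrix to the one with rows (a, l b) and (c / l, d),
  which still lies in Gamma_0(2); hence the second multiplier has \<open>c div l\<close>.\<close>

lemma wronskian_quotient_theta4_double_sq_Gamma0:
  fixes a b c d :: int and l :: nat
  assumes det: "a * d - b * c = 1" and c: "2 * int l dvd c" and l: "l > 0" and \<tau>: "Im \<tau> > 0"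
  shows "wronskian_quotient theta4_double_sq (\<lambda>z. theta4_double_sq (of_nat l * z)) ((of_int a * \<tau> + of_int b) / (of_int c * \<tau> + of_int d)) =
    wronskian_quotient theta4_double_sq (\<lambda>z. theta4_double_sq (of_nat l * z)) \<tau> / (theta4_multiplier c d * theta4_multiplier (c div l) d)"
proof -
  obtain e where e: "c = int l * e" "even e"
    using c by (metis dvdE dvd_triv_left mult.assoc mult.commute)
  have ce: "c div l = e" using e l by simp
  have ev: "even c" using e by simp
  have det': "a * d - (int l * b) * e = 1" using det by (simp add: e algebra_simps)
  have Gl: "theta4_double_sq (of_nat l * ((of_int a * z + of_int b) / (of_int c * z + of_int d))) =
    theta4_multiplier e d * (of_int c * z + of_int d) * theta4_double_sq (of_nat l * z)" if z: "Im z > 0" for z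
    using theta4_double_sq_Gamma0_2[OF det' e(2), of "of_nat l * z"] z l by (simp add: e algebra_simps)
  have rdet: "real_of_int a * of_int d - of_int b * of_int c = 1"
    using det by (simp flip: of_int_mult of_int_diff)
  show ?thesis
    using wronskian_quotient_moebius[of "of_int a" "of_int d" "of_int b" "of_int c" theta4_double_sq "\<lambda>z. theta4_double_sq (of_nat l * z)" "theta4_multiplier c d" theta4_double_sq "theta4_multiplier e d"
        "\<lambda>z. theta4_double_sq (of_nat l * z)" \<tau>] theta4_double_sq_Gamma0_2[OF det ev] Gl holomorphic_theta4_double_sq holomorphic_theta4_double_sq_mult[OF l]
        theta4_double_sq_nonzero theta4_double_sq_mult_nonzero[OF l] \<tau> unfolding ce rdet by simp
qed

text \<open>Let w be the Moebius map in the statement. Then w(tau) is the matrix with rows (a, b),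
  (2c, d l) applied to l tau, and l w(tau) is the one with rows (a l, b), (2c, d) applied to tau.
  Both lie in Gamma_0(2), so the two forms are exchanged, and the minus sign is the antisymmetry.
  The determinant \<open>l\<close> cancels a factor 1/l in the second law.\<close>

lemma wronskian_quotient_theta4_double_sq_Atkin_Lehner:
  fixes a b c d :: int and l :: nat
  assumes det: "a * d * l - 2 * b * c = 1" and l: "l > 0" and \<tau>: "Im \<tau> > 0"
  shows "wronskian_quotient theta4_double_sq (\<lambda>z. theta4_double_sq (of_nat l * z)) ((of_int (a * l) * \<tau> + of_int b) / (of_int (2 * l * c) * \<tau> + of_int (d * l))) =
    - wronskian_quotient theta4_double_sq (\<lambda>z. theta4_double_sq (of_nat l * z)) \<tau> / (theta4_multiplier (2 * c) (d * l) * theta4_multiplier (2 * c) d)"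
proof -
  have det1: "a * (d * l) - b * (2 * c) = 1" and det2: "(a * l) * d - b * (2 * c) = 1"
    using det by (simp_all add: algebra_simps)
  have ev: "even (2 * c)" by simp
  have G1: "theta4_double_sq ((of_int (a * l) * z + of_int b) / (of_int (2 * l * c) * z + of_int (d * l))) =
    theta4_multiplier (2 * c) (d * l) * (of_int (2 * l * c) * z + of_int (d * l)) * theta4_double_sq (of_nat l * z)" if z: "Im z > 0" for z
    using theta4_double_sq_Gamma0_2[OF det1 ev, of "of_nat l * z"] z l by (simp add: mult_ac)
  have G2: "theta4_double_sq (of_nat l * ((of_int (a * l) * z + of_int b) / (of_int (2 * l * c) * z + of_int (d * l)))) =
    theta4_multiplier (2 * c) d / of_nat l * (of_int (2 * l * c) * z + of_int (d * l)) * theta4_double_sq z" if z: "Im z > 0" for z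
  proof -
    have den: "of_int (2 * l * c) * z + of_int (d * l) = of_nat l * (of_int (2 * c) * z + of_int d)"
      by (simp add: algebra_simps)
    show ?thesis unfolding den using theta4_double_sq_Gamma0_2[OF det2 ev z] l by simp
  qed
  have "real_of_int (a * l * (d * l) - b * (2 * l * c)) = of_int (l * (a * d * l - 2 * b * c))"
    by (simp add: algebra_simps)
  hence rdet: "real_of_int (a * l) * of_int (d * l) - of_int b * of_int (2 * l * c) = real l"
    unfolding det by (simp flip: of_int_mult of_int_diff)
  have l': "real l > 0" using l by simp
  have "wronskian_quotient theta4_double_sq (\<lambda>z. theta4_double_sq (of_nat l * z)) ((of_int (a * l) * \<tau> + of_int b) / (of_int (2 * l * c) * \<tau> + of_int (d * l))) =
    wronskian_quotient (\<lambda>z. theta4_double_sq (of_nat l * z)) theta4_double_sq \<tau> / (of_nat l * theta4_multiplier (2 * c) (d * l) * (theta4_multiplier (2 * c) d / of_nat l))"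
    using wronskian_quotient_moebius[of "of_int (a * l)" "of_int (d * l)" "of_int b" "of_int (2 * l * c)" theta4_double_sq "\<lambda>z. theta4_double_sq (of_nat l * z)"
        "theta4_multiplier (2 * c) (d * l)" "\<lambda>z. theta4_double_sq (of_nat l * z)" "theta4_multiplier (2 * c) d / of_nat l" theta4_double_sq \<tau>]
      G1 G2 holomorphic_theta4_double_sq holomorphic_theta4_double_sq_mult[OF l] theta4_double_sq_nonzero theta4_double_sq_mult_nonzero[OF l] \<tau> l'
    unfolding rdet of_real_of_int_eq of_real_of_nat_eq by blast
  also have "wronskian_quotient (\<lambda>z. theta4_double_sq (of_nat l * z)) theta4_double_sq \<tau> = - wronskian_quotient theta4_double_sq (\<lambda>z. theta4_double_sq (of_nat l * z)) \<tau>"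
  proof (rule wronskian_quotient_swap)
    have "\<tau> \<in> upper_half_plane" using \<tau> by (simp add: upper_half_plane_def)
    thus "theta4_double_sq field_differentiable at \<tau>" "(\<lambda>z. theta4_double_sq (of_nat l * z)) field_differentiable at \<tau>"
      using holomorphic_theta4_double_sq holomorphic_theta4_double_sq_mult[OF l] open_upper_half_plane
      by (auto intro: holomorphic_on_imp_differentiable_at)
  qed (use theta4_double_sq_nonzero theta4_double_sq_mult_nonzero[OF l] \<tau> in auto)
  finally show ?thesis using l by simp
qed

lemma holomorphic_wronskian_quotient_theta4_double_sq:
  assumes "l > 0"
  shows "wronskian_quotient theta4_double_sq (\<lambda>z. theta4_double_sq (of_nat l * z)) holomorphic_on upper_half_plane"
proof -
  have "(\<lambda>z. theta4_double_sq (of_nat l * z) / theta4_double_sq z) holomorphic_on upper_half_plane"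
    using theta4_double_sq_nonzero by (intro holomorphic_intros holomorphic_theta4_double_sq holomorphic_theta4_double_sq_mult assms)
      (auto simp: upper_half_plane_def)
  hence D: "deriv (\<lambda>z. theta4_double_sq (of_nat l * z) / theta4_double_sq z) holomorphic_on upper_half_plane"
    by (rule holomorphic_deriv[OF _ open_upper_half_plane])
  have S: "(\<lambda>\<tau>. (theta4_double_sq (of_nat l * \<tau>))\<^sup>2) holomorphic_on upper_half_plane"
    by (intro holomorphic_intros holomorphic_theta4_double_sq_mult assms)
  show ?thesis unfolding wronskian_quotient_def[abs_def]
    by (rule holomorphic_on_divide[OF holomorphic_on_divide[OF D S] holomorphic_on_const])
      (use theta4_double_sq_mult_nonzero[OF assms] in \<open>auto simp: upper_half_plane_def\<close>)
qed

lemma wronskian_quotient_theta4_double_sq_meromorphic_at_cusp: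
  fixes a b c d :: int and l :: nat
  assumes det: "a * d - b * c = 1" and l: "l > 0"
  shows "\<exists>h::nat. h > 0 \<and> (\<exists>E. E meromorphic_on {0} \<and> (\<forall>\<tau>. Im \<tau> > 0 \<longrightarrow>
    wronskian_quotient theta4_double_sq (\<lambda>z. theta4_double_sq (of_nat l * z)) ((of_int a * \<tau> + of_int b) / (of_int c * \<tau> + of_int d)) =
    E (exp (2 * of_real pi * \<i> * \<tau> / of_nat h))))"
proof -
  have l2: "2 * l > 0" using l by simp
  let ?m = "\<lambda>\<tau>. (of_int a * \<tau> + of_int b) / (of_int c * \<tau> + of_int d) :: complex"
  obtain V k p s r where V: "V \<in> theta_squares" "k \<noteq> 0" "p > 0" "s > 0" and
    Veq: "\<And>\<tau>. Im \<tau> > 0 \<Longrightarrow> (theta4_const (of_nat 2 * ?m \<tau>))\<^sup>2 =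
      k * (of_int c * \<tau> + of_int d) * V ((of_nat p * \<tau> + of_int r) / of_nat s)"
    using theta4_const_square_cusp[OF det zero_less_numeral, of "num.Bit0 num.One"] by blast
  obtain V' k' p' s' r' where V': "V' \<in> theta_squares" "k' \<noteq> 0" "p' > 0" "s' > 0" and
    Veq': "\<And>\<tau>. Im \<tau> > 0 \<Longrightarrow> (theta4_const (of_nat (2 * l) * ?m \<tau>))\<^sup>2 =
      k' * (of_int c * \<tau> + of_int d) * V' ((of_nat p' * \<tau> + of_int r') / of_nat s')"
    using theta4_const_square_cusp[OF det, of "2 * l", OF l2] by blast
  define U1 where "U1 = (\<lambda>\<tau>. V ((of_nat p * \<tau> + of_int r) / of_nat s))"
  define U2 where "U2 = (\<lambda>\<tau>. V' ((of_nat p' * \<tau> + of_int r') / of_nat s'))"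
  have G1: "theta4_double_sq (?m \<tau>) = k * (of_int c * \<tau> + of_int d) * U1 \<tau>" if "Im \<tau> > 0" for \<tau>
    using Veq[OF that] by (simp add: theta4_double_sq_def U1_def)
  have G2: "theta4_double_sq (of_nat l * ?m \<tau>) = k' * (of_int c * \<tau> + of_int d) * U2 \<tau>" if "Im \<tau> > 0" for \<tau>
    using Veq'[OF that] by (simp add: theta4_double_sq_def U2_def mult.assoc)
  have rdet: "real_of_int a * of_int d - of_int b * of_int c = 1"
    using det by (simp flip: of_int_mult of_int_diff)
  have wronskian_quotient: "wronskian_quotient theta4_double_sq (\<lambda>z. theta4_double_sq (of_nat l * z)) (?m \<tau>) = wronskian_quotient U1 U2 \<tau> / (k * k')" if "Im \<tau> > 0" for \<tau>
    using wronskian_quotient_moebius[of "of_int a" "of_int d" "of_int b" "of_int c" theta4_double_sq "\<lambda>z. theta4_double_sq (of_nat l * z)" k U1 k' U2 \<tau>]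
      G1 G2 holomorphic_theta4_double_sq holomorphic_theta4_double_sq_mult[OF l] theta4_double_sq_nonzero theta4_double_sq_mult_nonzero[OF l] that
    unfolding rdet by simp
  \<comment> \<open>A common width for both expansions: each denominator acts as the factor
    \<open>K\<close> for the other.\<close>
  define h where "h = 4 * s * s'"
  have h: "h > 0" using V V' by (simp add: h_def)
  obtain F1 where F1: "F1 holomorphic_on ball 0 1" "\<And>\<tau>. U1 \<tau> = F1 (exp (2 * of_real pi * \<i> * \<tau> / of_nat h))"
    using theta_squares_affine_expansion[OF V(1,3,4) V'(4), of r] unfolding U1_def h_def by blast
  obtain F2 where F2: "F2 holomorphic_on ball 0 1" "\<And>\<tau>. U2 \<tau> = F2 (exp (2 * of_real pi * \<i> * \<tau> / of_nat h))"
    using theta_squares_affine_expansion[OF V'(1,3,4) V(4), of r'] unfolding U2_def h_def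
    by (auto simp only: mult.assoc mult.commute[of s])
  have nz: "U1 \<tau> \<noteq> 0" if "Im \<tau> > 0" for \<tau>
    unfolding U1_def using theta_squares_nonzero[OF V(1), of "(of_nat p * \<tau> + of_int r) / of_nat s"]
      moebius_upper_half_plane_int(2)[of p s r 0 \<tau>] V that by simp
  obtain E where E: "E meromorphic_on {0}"
    "\<And>\<tau>. Im \<tau> > 0 \<Longrightarrow> wronskian_quotient U1 U2 \<tau> = E (exp (2 * of_real pi * \<i> * \<tau> / of_nat h))"
    using wronskian_quotient_meromorphic[OF F1(1) F2(1) h F1(2) F2(2) nz] by blast
  have "(\<lambda>w. E w / (k * k')) meromorphic_on {0}" by (intro meromorphic_intros E)
  thus ?thesis using h wronskian_quotient E(2) by (intro exI[of _ h] conjI exI[of _ "\<lambda>w. E w / (k * k')"]) auto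
qed

section \<open>From the matrices to the generated group\<close>

lemma moebius_act_upper_half_plane:
  assumes "det A = 1" "\<tau> \<in> upper_half_plane"
  shows "moebius_act A \<tau> \<in> upper_half_plane"
  using moebius_upper_half_plane(2)[of "A$1$1" "A$2$2" "A$1$2" "A$2$1" \<tau>] assms
  by (simp add: moebius_act_def upper_half_plane_def det_2)

lemma moebius_act_mult:
  assumes "det B = 1" "\<tau> \<in> upper_half_plane"
  shows "moebius_act (A ** B) \<tau> = moebius_act A (moebius_act B \<tau>)"
proof -
  have nz: "of_real (B$2$1) * \<tau> + of_real (B$2$2) \<noteq> 0"
    using moebius_upper_half_plane(1)[of "B$1$1" "B$2$2" "B$1$2" "B$2$1" \<tau>] assms
    by (simp add: upper_half_plane_def det_2)
  define N where "N = of_real (B$2$1) * \<tau> + of_real (B$2$2)"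
  define M where "M = of_real (B$1$1) * \<tau> + of_real (B$1$2)"
  have "moebius_act A (moebius_act B \<tau>) =
    ((of_real (A$1$1) * M + of_real (A$1$2) * N) / N) / ((of_real (A$2$1) * M + of_real (A$2$2) * N) / N)"
    using nz by (simp add: moebius_act_def N_def[symmetric] M_def[symmetric] add_divide_distrib)
  also have "\<dots> = (of_real (A$1$1) * M + of_real (A$1$2) * N) / (of_real (A$2$1) * M + of_real (A$2$2) * N)"
    using nz by (simp add: N_def)
  also have "\<dots> = moebius_act (A ** B) \<tau>"
    by (simp add: moebius_act_def matrix_matrix_mult_def sum_2 M_def N_def algebra_simps)
  finally show ?thesis ..
qed

lemma moebius_act_one: "moebius_act (mat 1) \<tau> = \<tau>"
  by (simp add: moebius_act_def mat_def)

lemma generate_invariant: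
  assumes S: "S \<subseteq> carrier SL2R"
    and inv: "\<And>A \<tau>. A \<in> S \<Longrightarrow> \<tau> \<in> upper_half_plane \<Longrightarrow> f (moebius_act A \<tau>) = f \<tau>"
    and A: "A \<in> generate SL2R S" and \<tau>: "\<tau> \<in> upper_half_plane"
  shows "f (moebius_act A \<tau>) = f \<tau>"
proof -
  interpret group SL2R by (rule group_SL2R)
  have car: "det B = 1" if "B \<in> generate SL2R S" for B
    using generate_in_carrier[OF S that] by (simp add: SL2R_def)
  from A \<tau> show ?thesis
  proof (induction arbitrary: \<tau> rule: generate.induct)
    case one
    thus ?case by (simp add: SL2R_def moebius_act_one)
  next
    case (incl h)
    thus ?case using inv by blast
  next
    case (inv h)
    have h: "h \<in> carrier SL2R" using inv S by blast
    have d: "det (inv\<^bsub>SL2R\<^esub> h) = 1" using inv_closed[OF h] by (simp add: SL2R_def)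
    have "h ** inv\<^bsub>SL2R\<^esub> h = mat 1" using r_inv[OF h] by (simp add: SL2R_def)
    hence "\<tau> = moebius_act h (moebius_act (inv\<^bsub>SL2R\<^esub> h) \<tau>)"
      using moebius_act_mult[OF d inv.prems, of h] by (simp add: moebius_act_one)
    thus ?case using assms(2)[OF inv.hyps moebius_act_upper_half_plane[OF d inv.prems]] by simp
  next
    case (eng h1 h2)
    have d: "det h2 = 1" using car eng by blast
    thus ?case using eng.IH moebius_act_mult[OF d eng.prems, of h1] moebius_act_upper_half_plane[OF d eng.prems] eng.prems
      by (simp add: SL2R_def)
  qed
qed

theorem theorem3p1:
  fixes l :: nat and W :: "real^2^2"
  assumes "prime l" and "odd l"
    and "W \<in> Atkin_Lehner (2 * l) l"
  shows "modular_function_on (Gamma0_plus (2 * l) W)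
           (\<lambda>\<tau>. let q = exp (of_real pi * \<i> * \<tau>) in Dhat l (q\<^sup>2) ^ omega l)"
proof -
  have l: "l > 0" using \<open>prime l\<close> by (rule prime_gt_0_nat)
  define P where "P = wronskian_quotient theta4_double_sq (\<lambda>z. theta4_double_sq (of_nat l * z))"
  define f where "f = (\<lambda>\<tau>. let q = exp (of_real pi * \<i> * \<tau>) in Dhat l (q\<^sup>2) ^ omega l)"
  have f_eq: "f \<tau> = P \<tau> ^ omega l" if "Im \<tau> > 0" for \<tau>
    using Dhat_conv_wronskian_quotient[OF l that] by (simp add: f_def P_def Let_def)
  have ol: "odd (int l)" using \<open>odd l\<close> by simp
  have omega: "omega l = 2 \<or> omega l = 1 \<and> int l mod 4 = 3"
  proof (cases "l mod 4 = 1")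
    case False
    hence "l mod 4 = 3" using \<open>odd l\<close> by presburger
    hence "int l mod 4 = 3" by (metis of_nat_mod of_nat_numeral)
    thus ?thesis using False by (simp add: omega_def cong_def)
  qed (simp add: omega_def cong_def)
  \<comment> \<open>Both invariance proofs reduce to this: the residual constant must be a sign in
    general, and equal to 1 when the exponent is 1.\<close>
  have unit: "(x / y) ^ omega l = x ^ omega l" if "y\<^sup>2 = 1" "int l mod 4 = 3 \<Longrightarrow> y = 1" for x y :: complex
    using omega that by (auto simp: power_divide)
  have inv_Gamma0: "f (moebius_act A \<tau>) = f \<tau>" if A: "A \<in> Gamma0 (2 * l)" and \<tau>: "\<tau> \<in> upper_half_plane" for A \<tau>
  proof -
    obtain a b c d :: int where A_eq: "A = mat2 (of_int a) (of_int b) (of_int c) (of_int d)"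
      and det: "a * d - b * c = 1" and c: "2 * int l dvd c"
      using A by (auto simp: Gamma0_def cong_0_iff)
    have \<tau>': "Im \<tau> > 0" using \<tau> by (simp add: upper_half_plane_def)
    have "moebius_act A \<tau> = (of_int a * \<tau> + of_int b) / (of_int c * \<tau> + of_int d)"
      by (simp add: A_eq moebius_act_def)
    moreover have "Im ((of_int a * \<tau> + of_int b) / (of_int c * \<tau> + of_int d)) > 0"
      using moebius_upper_half_plane_int(2)[of a d b c] det \<tau>' by simp
    ultimately have "f (moebius_act A \<tau>) = (P \<tau> / (theta4_multiplier c d * theta4_multiplier (c div l) d)) ^ omega l"
      using wronskian_quotient_theta4_double_sq_Gamma0[OF det c l \<tau>'] by (simp add: f_eq P_def)
    also have "\<dots> = P \<tau> ^ omega l"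
    proof -
      have "c = int l * (c div l)" "even (c div l)" using c l by (auto elim!: dvdE simp: mult_ac)
      thus ?thesis using theta4_multiplier_mult_left[of "c div l" l d] ol by (intro unit) simp_all
    qed
    finally show ?thesis by (simp add: f_eq \<tau>')
  qed
  have inv_W: "f (moebius_act W \<tau>) = f \<tau>" if \<tau>: "\<tau> \<in> upper_half_plane" for \<tau>
  proof -
    obtain a b c d :: int where W: "W = mat2 (of_int a * sqrt (real l)) (of_int b / sqrt (real l))
        (of_int c * real (2 * l) / sqrt (real l)) (of_int d * sqrt (real l))" and "det W = 1"
      using assms(3) by (auto simp: Atkin_Lehner_def)
    hence "real_of_int (a * d * l - 2 * b * c) = 1" using l by (simp add: det_mat2 field_simps)
    hence det: "a * d * l - 2 * b * c = 1" by (simp only: of_int_eq_1_iff)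
    have \<tau>': "Im \<tau> > 0" using \<tau> by (simp add: upper_half_plane_def)
    \<comment> \<open>Expanding the fraction by the square root of \<open>l\<close> replaces the
      entries of \<open>W\<close> by integers and changes the determinant to
      \<open>l\<close>.\<close>
    define z :: complex where "z = of_real (sqrt (real l))"
    have z: "z \<noteq> 0" "z * z = of_nat l"
      using l by (simp_all add: z_def flip: of_real_mult)
    have "moebius_act W \<tau> = (of_int a * z * \<tau> + of_int b / z) / (of_int c * of_nat (2 * l) / z * \<tau> + of_int d * z)"
      by (simp add: W moebius_act_def z_def)
    also have "\<dots> = ((of_int a * z * \<tau> + of_int b / z) * z) / ((of_int c * of_nat (2 * l) / z * \<tau> + of_int d * z) * z)"
      using z by simp
    also have "\<dots> = (of_int (a * l) * \<tau> + of_int b) / (of_int (2 * l * c) * \<tau> + of_int (d * l))"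
    proof (intro arg_cong2[of _ _ _ _ "(/)"])
      have "(of_int a * z * \<tau> + of_int b / z) * z = of_int a * (z * z) * \<tau> + of_int b"
        using z(1) by (simp add: field_simps)
      thus "(of_int a * z * \<tau> + of_int b / z) * z = of_int (a * l) * \<tau> + of_int b"
        by (simp add: z(2))
      have "(of_int c * of_nat (2 * l) / z * \<tau> + of_int d * z) * z =
          of_int c * of_nat (2 * l) * \<tau> + of_int d * (z * z)"
        using z(1) by (simp add: field_simps)
      thus "(of_int c * of_nat (2 * l) / z * \<tau> + of_int d * z) * z = of_int (2 * l * c) * \<tau> + of_int (d * l)"
        by (simp add: z(2) mult_ac)
    qed
    finally have Wact: "moebius_act W \<tau> = (of_int (a * l) * \<tau> + of_int b) / (of_int (2 * l * c) * \<tau> + of_int (d * l))" .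
    have "Im (moebius_act W \<tau>) > 0"
      using moebius_act_upper_half_plane[OF \<open>det W = 1\<close> \<tau>] by (simp add: upper_half_plane_def)
    hence "f (moebius_act W \<tau>) = (P \<tau> / - (theta4_multiplier (2 * c) (d * l) * theta4_multiplier (2 * c) d)) ^ omega l"
      using wronskian_quotient_theta4_double_sq_Atkin_Lehner[OF det l \<tau>'] by (simp add: f_eq P_def Wact)
    also have "\<dots> = P \<tau> ^ omega l"
    proof (rule unit)
      \<comment> \<open>The determinant condition forces \<open>d\<close> to be odd, as the
        multiplier identity requires.\<close>
      have "a * d * l = 2 * (b * c) + 1" using det by (simp add: algebra_simps)
      hence "odd (a * d * l)" by simp
      hence "odd d" by simp
      thus "(- (theta4_multiplier (2 * c) (d * l) * theta4_multiplier (2 * c) d))\<^sup>2 = 1"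
        "int l mod 4 = 3 \<Longrightarrow> - (theta4_multiplier (2 * c) (d * l) * theta4_multiplier (2 * c) d) = 1"
        using theta4_multiplier_mult_right[of "2 * c" l d] ol by simp_all
    qed
    finally show ?thesis by (simp add: f_eq \<tau>')
  qed
  have "f nicely_meromorphic_on upper_half_plane"
  proof -
    have "(\<lambda>\<tau>. P \<tau> ^ omega l) holomorphic_on upper_half_plane"
      unfolding P_def by (intro holomorphic_intros holomorphic_wronskian_quotient_theta4_double_sq l)
    hence "f holomorphic_on upper_half_plane"
      by (rule holomorphic_transform) (simp add: f_eq upper_half_plane_def)
    thus ?thesis using open_upper_half_plane
      by (intro analytic_on_imp_nicely_meromorphic_on) (simp add: analytic_on_open)
  qed
  moreover have "f (moebius_act A \<tau>) = f \<tau>" if "A \<in> Gamma0_plus (2 * l) W" "\<tau> \<in> upper_half_plane" for A \<tau>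
    using that unfolding Gamma0_plus_def
    by (rule generate_invariant[rotated 2])
      (use Gamma0_subset_SL2R subsetD[OF Atkin_Lehner_subset_SL2R assms(3)] inv_Gamma0 inv_W in auto)
  moreover have "meromorphic_at_ii_inf (\<lambda>\<tau>. f (moebius_act A \<tau>))" if A: "A \<in> SL2Z" for A
  proof -
    obtain a b c d :: int where A_eq: "A = mat2 (of_int a) (of_int b) (of_int c) (of_int d)"
      and det: "a * d - b * c = 1" using A by (auto simp: SL2Z_def)
    obtain h E where h: "h > (0::nat)" and E: "E meromorphic_on {0}"
      "\<And>\<tau>. Im \<tau> > 0 \<Longrightarrow> P ((of_int a * \<tau> + of_int b) / (of_int c * \<tau> + of_int d)) = E (exp (2 * of_real pi * \<i> * \<tau> / of_nat h))"
      using wronskian_quotient_theta4_double_sq_meromorphic_at_cusp[OF det l] unfolding P_def by blast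
    have "(\<lambda>w. E w ^ omega l) meromorphic_on {0}" by (intro meromorphic_intros E)
    moreover have "f (moebius_act A \<tau>) = E (exp (2 * of_real pi * \<i> * \<tau> / of_nat h)) ^ omega l" if "Im \<tau> > 0" for \<tau>
    proof -
      have "Im ((of_int a * \<tau> + of_int b) / (of_int c * \<tau> + of_int d)) > 0"
        using moebius_upper_half_plane_int(2)[of a d b c] det that by simp
      thus ?thesis using E(2)[OF that] by (simp add: A_eq moebius_act_def f_eq)
    qed
    ultimately show ?thesis unfolding meromorphic_at_ii_inf_def using h
      by (intro exI[of _ h] conjI exI[of _ "\<lambda>w. E w ^ omega l"] exI[of _ 0]) auto
  qed
  ultimately show ?thesis unfolding modular_function_on_def f_def[symmetric] by blast
qed

end
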